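(* Let $M\ge 1$ be an integer and let $g_{i,m}$, $i\in\{1,\dots,2M\}$, $m\in\{1,\dots,M\}$, be given real numbers. Let $\Pi$ be the set of all pairings, i.e. all assignments $m\mapsto(\ell_{2m-1},\ell_{2m})$, $m=1,\dots,M$, such that $(\ell_1,\dots,\ell_{2M})$ is a permutation of $(1,\dots,2M)$. Then the optimization problem $$\max_{(\ell_{2m-1},\ell_{2m})\in\Pi}\ \sum_{m=1}^M \left(g_{\ell_{2m-1},m}+g_{\ell_{2m},m}\right)$$ can be solved optimally using the Hungarian algorithm, with polynomial time complexity in $M$.
   Context: The Hungarian algorithm takes as input an $n\times n$ matrix of nonnegative costs $(z_{i,j})$ and returns a permutation $\sigma$ of $\{1,\dots,n\}$ minimizing $\sum_{i=1}^n z_{i,\sigma(i)}$ (the linear assignment problem), in time polynomial in $n$ (namely $\mathcal{O}(n^3)$ arithmetic operations). "Solved optimally" means that a pairing attaining the maximum is computed. Complexity is counted in arithmetic operations and comparisons. *)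

theory Defs
  imports
    "HOL-Combinatorics.Permutations"
    "HOL-Computational_Algebra.Polynomial"
begin

section \<open>Pairings\<close>

definition pairings :: "nat \<Rightarrow> (nat \<Rightarrow> nat \<times> nat) set" where
  "pairings M = {\<pi>. \<exists>l. l permutes {1..2 * M} \<and>
                        (\<forall>m\<in>{1..M}. \<pi> m = (l (2 * m - 1), l (2 * m)))}"

definition pairing_value :: "nat \<Rightarrow> (nat \<Rightarrow> nat \<Rightarrow> real) \<Rightarrow> (nat \<Rightarrow> nat \<times> nat) \<Rightarrow> real" where
  "pairing_value M g \<pi> = (\<Sum>m = 1..M. g (fst (\<pi> m)) m + g (snd (\<pi> m)) m)"


section \<open>A machine model counting arithmetic operations and comparisons\<close>

text \<open>
  Imperative programs over a memory of arrays of natural numbers (used for indices) and arrays of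
  real numbers. A cell is addressed by a name and a list of indices; scalars are the cells with the
  empty index list. A real number can influence the control flow only through comparisons and
  cannot be converted to an index. Every arithmetic operation and every comparison, on indices as
  well as on reals, costs one unit.
\<close>

type_synonym name = string

record memory =
  ints :: "name \<Rightarrow> nat list \<Rightarrow> nat"
  reals :: "name \<Rightarrow> nat list \<Rightarrow> real"

datatype iexp =
    N nat
  | I name "iexp list"
  | IAdd iexp iexp  (infixl "\<oplus>\<^sub>i" 65)
  | ISub iexp iexp  (infixl "\<ominus>\<^sub>i" 65)

datatype rexp =
    C int
  | R name "iexp list"
  | RAdd rexp rexp  (infixl "\<oplus>\<^sub>r" 65)
  | RSub rexp rexp  (infixl "\<ominus>\<^sub>r" 65)

datatype bexp =
    IEq iexp iexp   (infix "=\<^sub>i" 50)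
  | ILe iexp iexp   (infix "\<le>\<^sub>i" 50)
  | RLess rexp rexp (infix "<\<^sub>r" 50)
  | Not bexp

datatype com =
    IAssign name "iexp list" iexp  ("(_ _/ :=\<^sub>i _)" [1000, 1000, 62] 62)
  | RAssign name "iexp list" rexp  ("(_ _/ :=\<^sub>r _)" [1000, 1000, 62] 62)
  | Skip                           ("SKIP")
  | Seq com com                    ("_;;/ _" [60, 61] 60)
  | If bexp com com                ("(IF _/ THEN _/ ELSE _)" [0, 0, 61] 61)
  | While bexp com                 ("(WHILE _/ DO _)" [0, 61] 61)

abbreviation V :: "name \<Rightarrow> iexp" where
  "V x \<equiv> I x []"

fun ieval :: "memory \<Rightarrow> iexp \<Rightarrow> nat" where
  "ieval s (N k) = k"
| "ieval s (I x es) = ints s x (map (ieval s) es)"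
| "ieval s (a \<oplus>\<^sub>i b) = ieval s a + ieval s b"
| "ieval s (a \<ominus>\<^sub>i b) = ieval s a - ieval s b"

fun reval :: "memory \<Rightarrow> rexp \<Rightarrow> real" where
  "reval s (C k) = of_int k"
| "reval s (R x es) = reals s x (map (ieval s) es)"
| "reval s (a \<oplus>\<^sub>r b) = reval s a + reval s b"
| "reval s (a \<ominus>\<^sub>r b) = reval s a - reval s b"

fun beval :: "memory \<Rightarrow> bexp \<Rightarrow> bool" where
  "beval s (a =\<^sub>i b) = (ieval s a = ieval s b)"
| "beval s (a \<le>\<^sub>i b) = (ieval s a \<le> ieval s b)"
| "beval s (a <\<^sub>r b) = (reval s a < reval s b)"
| "beval s (Not b) = (\<not> beval s b)"

fun icost :: "iexp \<Rightarrow> nat" where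
  "icost (N k) = 0"
| "icost (I x es) = sum_list (map icost es)"
| "icost (a \<oplus>\<^sub>i b) = icost a + icost b + 1"
| "icost (a \<ominus>\<^sub>i b) = icost a + icost b + 1"

fun rcost :: "rexp \<Rightarrow> nat" where
  "rcost (C k) = 0"
| "rcost (R x es) = sum_list (map icost es)"
| "rcost (a \<oplus>\<^sub>r b) = rcost a + rcost b + 1"
| "rcost (a \<ominus>\<^sub>r b) = rcost a + rcost b + 1"

fun bcost :: "bexp \<Rightarrow> nat" where
  "bcost (a =\<^sub>i b) = icost a + icost b + 1"
| "bcost (a \<le>\<^sub>i b) = icost a + icost b + 1"
| "bcost (a <\<^sub>r b) = rcost a + rcost b + 1"
| "bcost (Not b) = bcost b"

definition iupdate :: "name \<Rightarrow> nat list \<Rightarrow> nat \<Rightarrow> memory \<Rightarrow> memory" where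
  "iupdate x is k s = s\<lparr>ints := (ints s)(x := (ints s x)(is := k))\<rparr>"

definition rupdate :: "name \<Rightarrow> nat list \<Rightarrow> real \<Rightarrow> memory \<Rightarrow> memory" where
  "rupdate x is r s = s\<lparr>reals := (reals s)(x := (reals s x)(is := r))\<rparr>"

text \<open>
  \<open>run c s t s'\<close>: started in memory \<open>s\<close>, the program \<open>c\<close> halts in memory \<open>s'\<close> after exactly \<open>t\<close>
  arithmetic operations and comparisons.
\<close>

inductive run :: "com \<Rightarrow> memory \<Rightarrow> nat \<Rightarrow> memory \<Rightarrow> bool" where
  IAssign: "run (x es :=\<^sub>i a) s (sum_list (map icost es) + icost a)
              (iupdate x (map (ieval s) es) (ieval s a) s)"
| RAssign: "run (x es :=\<^sub>r a) s (sum_list (map icost es) + rcost a)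
              (rupdate x (map (ieval s) es) (reval s a) s)"
| Skip: "run SKIP s 0 s"
| Seq: "run c\<^sub>1 s t\<^sub>1 s\<^sub>1 \<Longrightarrow> run c\<^sub>2 s\<^sub>1 t\<^sub>2 s\<^sub>2 \<Longrightarrow> run (c\<^sub>1;; c\<^sub>2) s (t\<^sub>1 + t\<^sub>2) s\<^sub>2"
| IfTrue: "beval s b \<Longrightarrow> run c\<^sub>1 s t s' \<Longrightarrow> run (IF b THEN c\<^sub>1 ELSE c\<^sub>2) s (bcost b + t) s'"
| IfFalse: "\<not> beval s b \<Longrightarrow> run c\<^sub>2 s t s' \<Longrightarrow> run (IF b THEN c\<^sub>1 ELSE c\<^sub>2) s (bcost b + t) s'"
| WhileFalse: "\<not> beval s b \<Longrightarrow> run (WHILE b DO c) s (bcost b) s"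
| WhileTrue: "beval s b \<Longrightarrow> run c s t\<^sub>1 s\<^sub>1 \<Longrightarrow> run (WHILE b DO c) s\<^sub>1 t\<^sub>2 s\<^sub>2 \<Longrightarrow>
              run (WHILE b DO c) s (bcost b + t\<^sub>1 + t\<^sub>2) s\<^sub>2"

inductive_cases IAssignE: "run (x es :=\<^sub>i a) s t s'"
inductive_cases RAssignE: "run (x es :=\<^sub>r a) s t s'"
inductive_cases SkipE: "run SKIP s t s'"
inductive_cases SeqE: "run (c\<^sub>1;; c\<^sub>2) s t s'"
inductive_cases IfE: "run (IF b THEN c\<^sub>1 ELSE c\<^sub>2) s t s'"
inductive_cases WhileE: "run (WHILE b DO c) s t s'"

lemma run_deterministic:
  "run c s t s' \<Longrightarrow> run c s u s'' \<Longrightarrow> u = t \<and> s'' = s'"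
proof (induction arbitrary: u s'' rule: run.induct)
  case IAssign
  then show ?case by (auto elim: IAssignE)
next
  case RAssign
  then show ?case by (auto elim: RAssignE)
next
  case Skip
  then show ?case by (auto elim: SkipE)
next
  case Seq
  then show ?case by (metis SeqE)
next
  case IfTrue
  then show ?case by (metis IfE)
next
  case IfFalse
  then show ?case by (metis IfE)
next
  case WhileFalse
  then show ?case by (metis WhileE)
next
  case WhileTrue
  then show ?case by (metis WhileE)
qed

definition for_loop :: "name \<Rightarrow> iexp \<Rightarrow> iexp \<Rightarrow> com \<Rightarrow> com"
    ("(FOR _/ FROM _/ TO _/ DO _)" [0, 0, 0, 61] 61) where
  "FOR x FROM a TO b DO c =
     (x [] :=\<^sub>i a;; WHILE V x \<le>\<^sub>i b DO (c;; x [] :=\<^sub>i V x \<oplus>\<^sub>i N 1))"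


section \<open>The Hungarian algorithm\<close>

text \<open>
  Input: \<open>n\<close> and the cost matrix \<open>z[i,j]\<close>, \<open>1 \<le> i, j \<le> n\<close>. Output: the minimizing permutation
  \<open>sigma[1..n]\<close>. This is the \<open>O(n\<^sup>3)\<close> version: \<open>u\<close> (rows) and \<open>v\<close> (columns) are dual potentials with
  \<open>u[i] + v[j] \<le> z[i,j]\<close>, and \<open>p[j]\<close> is the row matched to column \<open>j\<close>, or 0 if \<open>j\<close> is free. The
  rows are inserted one at a time. The fictitious column 0 is matched to the row being inserted,
  and an alternating tree of tight edges is grown from it (its columns have \<open>used = 1\<close>) until it
  reaches a free column. For a column outside the tree, \<open>minv\<close> is the least reduced cost of an edge
  joining it to the tree and \<open>way\<close> is the column of the tree at which it is attained.
\<close>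

definition scan_columns :: com where
  "scan_columns =
     (''j1'' [] :=\<^sub>i N 0;;
      FOR ''j'' FROM N 1 TO V ''n'' DO
        IF I ''used'' [V ''j''] =\<^sub>i N 0 THEN (
          ''cur'' [] :=\<^sub>r R ''z'' [V ''i0'', V ''j''] \<ominus>\<^sub>r R ''u'' [V ''i0''] \<ominus>\<^sub>r R ''v'' [V ''j''];;
          IF R ''cur'' [] <\<^sub>r R ''minv'' [V ''j'']
          THEN (''minv'' [V ''j''] :=\<^sub>r R ''cur'' [];; ''way'' [V ''j''] :=\<^sub>i V ''j0'')
          ELSE SKIP;;
          IF V ''j1'' =\<^sub>i N 0
          THEN (''delta'' [] :=\<^sub>r R ''minv'' [V ''j''];; ''j1'' [] :=\<^sub>i V ''j'')
          ELSE IF R ''minv'' [V ''j''] <\<^sub>r R ''delta'' []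
          THEN (''delta'' [] :=\<^sub>r R ''minv'' [V ''j''];; ''j1'' [] :=\<^sub>i V ''j'')
          ELSE SKIP)
        ELSE SKIP)"

definition update_potentials :: com where
  "update_potentials =
     FOR ''j'' FROM N 0 TO V ''n'' DO
       IF I ''used'' [V ''j''] =\<^sub>i N 1 THEN (
         ''u'' [I ''p'' [V ''j'']] :=\<^sub>r R ''u'' [I ''p'' [V ''j'']] \<oplus>\<^sub>r R ''delta'' [];;
         ''v'' [V ''j''] :=\<^sub>r R ''v'' [V ''j''] \<ominus>\<^sub>r R ''delta'' [])
       ELSE ''minv'' [V ''j''] :=\<^sub>r R ''minv'' [V ''j''] \<ominus>\<^sub>r R ''delta'' []"

definition augment :: com where
  "augment =
     WHILE Not (V ''j0'' =\<^sub>i N 0) DO (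
       ''j1'' [] :=\<^sub>i I ''way'' [V ''j0''];;
       ''p'' [V ''j0''] :=\<^sub>i I ''p'' [V ''j1''];;
       ''j0'' [] :=\<^sub>i V ''j1'')"

definition insert_row :: com where
  "insert_row =
     (''p'' [N 0] :=\<^sub>i V ''i'';;
      ''j0'' [] :=\<^sub>i N 0;;
      ''used'' [N 0] :=\<^sub>i N 0;;
      FOR ''j'' FROM N 1 TO V ''n'' DO (
        ''used'' [V ''j''] :=\<^sub>i N 0;;
        ''minv'' [V ''j''] :=\<^sub>r R ''z'' [V ''i'', V ''j''] \<ominus>\<^sub>r R ''u'' [V ''i''] \<ominus>\<^sub>r R ''v'' [V ''j''];;
        ''way'' [V ''j''] :=\<^sub>i N 0);;
      WHILE Not (I ''p'' [V ''j0''] =\<^sub>i N 0) DO (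
        ''used'' [V ''j0''] :=\<^sub>i N 1;;
        ''i0'' [] :=\<^sub>i I ''p'' [V ''j0''];;
        scan_columns;;
        update_potentials;;
        ''j0'' [] :=\<^sub>i V ''j1'');;
      augment)"

definition hungarian :: com where
  "hungarian =
     (FOR ''j'' FROM N 0 TO V ''n'' DO (
        ''u'' [V ''j''] :=\<^sub>r C 0;; ''v'' [V ''j''] :=\<^sub>r C 0;; ''p'' [V ''j''] :=\<^sub>i N 0);;
      FOR ''i'' FROM N 1 TO V ''n'' DO insert_row;;
      FOR ''j'' FROM N 1 TO V ''n'' DO ''sigma'' [I ''p'' [V ''j'']] :=\<^sub>i V ''j'')"


section \<open>Solving the pairing problem with the Hungarian algorithm\<close>

text \<open>
  Columns \<open>m\<close> and \<open>M + m\<close> of the cost matrix stand for the two places of the \<open>m\<close>-th pair.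
  Subtracting from the largest entry of \<open>g\<close> turns maximization into minimization and makes the
  costs nonnegative.
\<close>

definition build_costs :: com where
  "build_costs =
     (''n'' [] :=\<^sub>i V ''M'' \<oplus>\<^sub>i V ''M'';;
      ''gmax'' [] :=\<^sub>r R ''g'' [N 1, N 1];;
      FOR ''i'' FROM N 1 TO V ''n'' DO FOR ''m'' FROM N 1 TO V ''M'' DO
        IF R ''gmax'' [] <\<^sub>r R ''g'' [V ''i'', V ''m'']
        THEN ''gmax'' [] :=\<^sub>r R ''g'' [V ''i'', V ''m''] ELSE SKIP;;
      FOR ''i'' FROM N 1 TO V ''n'' DO FOR ''m'' FROM N 1 TO V ''M'' DO (
        ''z'' [V ''i'', V ''m''] :=\<^sub>r R ''gmax'' [] \<ominus>\<^sub>r R ''g'' [V ''i'', V ''m''];;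
        ''z'' [V ''i'', V ''M'' \<oplus>\<^sub>i V ''m''] :=\<^sub>r R ''gmax'' [] \<ominus>\<^sub>r R ''g'' [V ''i'', V ''m'']))"

definition read_pairing :: com where
  "read_pairing =
     FOR ''i'' FROM N 1 TO V ''n'' DO (
       ''j'' [] :=\<^sub>i I ''sigma'' [V ''i''];;
       IF V ''j'' \<le>\<^sub>i V ''M''
       THEN ''l'' [V ''j'' \<oplus>\<^sub>i V ''j'' \<ominus>\<^sub>i N 1] :=\<^sub>i V ''i''
       ELSE ''l'' [(V ''j'' \<ominus>\<^sub>i V ''M'') \<oplus>\<^sub>i (V ''j'' \<ominus>\<^sub>i V ''M'')] :=\<^sub>i V ''i'')"

definition pairing_program :: com where
  "pairing_program = (build_costs;; hungarian;; read_pairing)"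

text \<open>Memory outside the problem data is arbitrary, in particular not assumed to be cleared.\<close>

definition holds_problem :: "nat \<Rightarrow> (nat \<Rightarrow> nat \<Rightarrow> real) \<Rightarrow> memory \<Rightarrow> bool" where
  "holds_problem M g s \<longleftrightarrow> ints s ''M'' [] = M \<and>
     (\<forall>i\<in>{1..2 * M}. \<forall>m\<in>{1..M}. reals s ''g'' [i, m] = g i m)"

definition stored_pairing :: "memory \<Rightarrow> nat \<Rightarrow> nat \<times> nat" where
  "stored_pairing s m = (ints s ''l'' [2 * m - 1], ints s ''l'' [2 * m])"

end

theory Submission
  imports Defs
begin

text \<open>
  A pairing is an assignment of the \<open>2M\<close> indices to the \<open>2M\<close> places, and its value is
  \<open>2M\<close> times the largest entry of \<open>g\<close> minus the cost of that assignment, so an optimal assignment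
  gives an optimal pairing. The Hungarian algorithm maintains a feasible dual solution \<open>u\<close>, \<open>v\<close>
  whose tight edges carry the current matching: shifting the potentials by the smallest reduced cost
  leaving the alternating tree keeps all of this true and makes a new column reachable, and flipping
  a path to a free column inserts one more row. Once the matching is perfect, weak duality shows
  that it is optimal. Every tree grows at most \<open>n\<close> times at linear cost, which gives a cubic bound.
\<close>

section \<open>Total correctness with a running time bound\<close>

text \<open>The program starts in uncleared memory, so nothing may be presumed about a cell before
  it is written. Each specification therefore comes with a frame computed from the program text, and
  the combinatorial invariants are stated for plain functions and only later instantiated with
  arrays. That a growth step costs linear rather than quadratic time rests on \<open>minv\<close>: a
  shift raises all tree rows alike, so the smallest slack of every outside column drops by the same
  amount. One subtraction keeps the stored minima correct, and only edges at the newly added row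
  have to be inspected. Zero potentials are the starting point, and nonnegative costs are what makes
  them feasible. The numerical factors in the time bounds are generous round figures, chosen so that
  simplification settles the inequalities; they are not exact counts.\<close>

lemma ints_iupdate [simp]:
  "ints (iupdate x es k s) y fs = (if y = x \<and> fs = es then k else ints s y fs)"
  by (simp add: iupdate_def)

lemma reals_iupdate [simp]: "reals (iupdate x es k s) = reals s"
  by (simp add: iupdate_def)

lemma ints_rupdate [simp]: "ints (rupdate x es r s) = ints s"
  by (simp add: rupdate_def)

lemma reals_rupdate [simp]:
  "reals (rupdate x es r s) y fs = (if y = x \<and> fs = es then r else reals s y fs)"
  by (simp add: rupdate_def)

section \<open>Frames: the names that a program may change\<close>

primrec imods :: "com \<Rightarrow> name set" where
  "imods (x es :=\<^sub>i a) = {x}"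
| "imods (x es :=\<^sub>r a) = {}"
| "imods SKIP = {}"
| "imods (c;; d) = imods c \<union> imods d"
| "imods (IF b THEN c ELSE d) = imods c \<union> imods d"
| "imods (WHILE b DO c) = imods c"

primrec rmods :: "com \<Rightarrow> name set" where
  "rmods (x es :=\<^sub>i a) = {}"
| "rmods (x es :=\<^sub>r a) = {x}"
| "rmods SKIP = {}"
| "rmods (c;; d) = rmods c \<union> rmods d"
| "rmods (IF b THEN c ELSE d) = rmods c \<union> rmods d"
| "rmods (WHILE b DO c) = rmods c"

lemma mods_for [simp]:
  "imods (FOR x FROM a TO b DO c) = insert x (imods c)"
  "rmods (FOR x FROM a TO b DO c) = rmods c"
  by (auto simp: for_loop_def)

text \<open>Names, not cells, are tracked: an array counts as changed once one of its cells may be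
  written. \<open>runs_mono\<close> and \<open>runs_seq\<close> supply this relation for free, so
  postconditions can concentrate on what a program writes.\<close>

definition agree :: "name set \<Rightarrow> name set \<Rightarrow> memory \<Rightarrow> memory \<Rightarrow> bool" where
  "agree X Y s s' \<longleftrightarrow> (\<forall>x. x \<notin> X \<longrightarrow> ints s' x = ints s x) \<and> (\<forall>y. y \<notin> Y \<longrightarrow> reals s' y = reals s y)"

lemma agreeD:
  assumes "agree X Y s s'"
  shows "x \<notin> X \<Longrightarrow> ints s' x = ints s x" and "y \<notin> Y \<Longrightarrow> reals s' y = reals s y"
  using assms by (auto simp: agree_def)

lemma agree_refl: "agree X Y s s"
  by (simp add: agree_def)

lemma agree_trans: "agree X Y s s' \<Longrightarrow> agree X Y s' s'' \<Longrightarrow> agree X Y s s''"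
  by (simp add: agree_def)

lemma agree_mono: "agree X Y s s' \<Longrightarrow> X \<subseteq> X' \<Longrightarrow> Y \<subseteq> Y' \<Longrightarrow> agree X' Y' s s'"
  by (auto simp: agree_def)

lemma agree_iupdate: "x \<in> X \<Longrightarrow> agree X Y s s' \<Longrightarrow> agree X Y s (iupdate x es k s')"
  by (auto simp: agree_def fun_eq_iff)

lemma agree_rupdate: "y \<in> Y \<Longrightarrow> agree X Y s s' \<Longrightarrow> agree X Y s (rupdate y es r s')"
  by (auto simp: agree_def fun_eq_iff)

lemma run_agree: "run c s t s' \<Longrightarrow> agree (imods c) (rmods c) s s'"
proof (induction rule: run.induct)
  case (IAssign x es a s)
  then show ?case by (simp add: agree_iupdate agree_refl)
next
  case (RAssign x es a s)
  then show ?case by (simp add: agree_rupdate agree_refl)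
qed (auto simp: agree_def)

text \<open>Time enters as an upper bound, so that both branches of a conditional and all passes of
  a loop can share one figure. Since \<open>run\<close> is deterministic, exhibiting one halting run
  describes the only one.\<close>

definition runs :: "com \<Rightarrow> memory \<Rightarrow> nat \<Rightarrow> (memory \<Rightarrow> bool) \<Rightarrow> bool" where
  "runs c s T Q \<longleftrightarrow> (\<exists>t s'. run c s t s' \<and> t \<le> T \<and> Q s')"

lemma runs_mono:
  "runs c s T Q \<Longrightarrow> T \<le> T' \<Longrightarrow> (\<And>s'. agree (imods c) (rmods c) s s' \<Longrightarrow> Q s' \<Longrightarrow> Q' s')
    \<Longrightarrow> runs c s T' Q'"
  unfolding runs_def by (meson order_trans run_agree)

lemma runs_seq:
  assumes "runs c s T Q" "\<And>s'. agree (imods c) (rmods c) s s' \<Longrightarrow> Q s' \<Longrightarrow> runs d s' T' Q'"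
  shows "runs (c;; d) s (T + T') Q'"
  using assms unfolding runs_def by (meson add_mono run.Seq run_agree)

text \<open>The index of the invariant is fuel bounding the passes still possible: 0 is no
  successor, so \<open>J 0 s\<close> forces the guard to be false. The loop may also stop with fuel
  left, hence the unspecified index at the end.\<close>

lemma runs_while:
  assumes step: "\<And>k s. J k s \<Longrightarrow> beval s b \<Longrightarrow> \<exists>k'. k = Suc k' \<and> runs c s T (J k')"
    and "J k s"
  shows "runs (WHILE b DO c) s (k * (T + bcost b) + bcost b) (\<lambda>s'. (\<exists>k'. J k' s') \<and> \<not> beval s' b)"
  using \<open>J k s\<close>
proof (induction k arbitrary: s)
  case 0
  then have "\<not> beval s b" using step by blast
  then show ?case unfolding runs_def using 0 WhileFalse by fastforce
next
  case (Suc k)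
  show ?case
  proof (cases "beval s b")
    case False
    then show ?thesis unfolding runs_def using Suc.prems WhileFalse
      by (intro exI[of _ "bcost b"] exI[of _ s]) auto
  next
    case True
    then have "runs c s T (J k)" using step Suc.prems by blast
    then obtain t s1 where 1: "run c s t s1" "t \<le> T" "J k s1" by (auto simp: runs_def)
    then obtain t' s2 where 2: "run (WHILE b DO c) s1 t' s2" "t' \<le> k * (T + bcost b) + bcost b"
      "(\<exists>k'. J k' s2) \<and> \<not> beval s2 b"
      using Suc.IH[OF 1(3)] by (auto simp: runs_def)
    show ?thesis unfolding runs_def
      using WhileTrue[OF True 1(1) 2(1)] 1(2) 2(2,3)
      by (intro exI[of _ "bcost b + t + t'"] exI[of _ s2]) auto
  qed
qed

section \<open>Loop-free programs\<close>

primrec straight :: "com \<Rightarrow> bool" where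
  "straight (x es :=\<^sub>i a) \<longleftrightarrow> True"
| "straight (x es :=\<^sub>r a) \<longleftrightarrow> True"
| "straight SKIP \<longleftrightarrow> True"
| "straight (c;; d) \<longleftrightarrow> straight c \<and> straight d"
| "straight (IF b THEN c ELSE d) \<longleftrightarrow> straight c \<and> straight d"
| "straight (WHILE b DO c) \<longleftrightarrow> False"

text \<open>As a function on memories, loop-free code can be executed symbolically by
  simplification. The \<open>WHILE\<close> equation is a filler, excluded by
  \<open>straight\<close>.\<close>

primrec exec :: "com \<Rightarrow> memory \<Rightarrow> memory" where
  "exec (x es :=\<^sub>i a) s = iupdate x (map (ieval s) es) (ieval s a) s"
| "exec (x es :=\<^sub>r a) s = rupdate x (map (ieval s) es) (reval s a) s"
| "exec SKIP s = s"
| "exec (c;; d) s = exec d (exec c s)"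
| "exec (IF b THEN c ELSE d) s = (if beval s b then exec c s else exec d s)"
| "exec (WHILE b DO c) s = s"

primrec ccost :: "com \<Rightarrow> nat" where
  "ccost (x es :=\<^sub>i a) = sum_list (map icost es) + icost a"
| "ccost (x es :=\<^sub>r a) = sum_list (map icost es) + rcost a"
| "ccost SKIP = 0"
| "ccost (c;; d) = ccost c + ccost d"
| "ccost (IF b THEN c ELSE d) = bcost b + max (ccost c) (ccost d)"
| "ccost (WHILE b DO c) = 0"

lemma run_straight: "straight c \<Longrightarrow> \<exists>t \<le> ccost c. run c s t (exec c s)"
proof (induction c arbitrary: s)
  case (Seq c d)
  obtain t where t: "t \<le> ccost c" "run c s t (exec c s)" using Seq by fastforce
  obtain u where u: "u \<le> ccost d" "run d (exec c s) u (exec d (exec c s))" using Seq by fastforce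
  show ?case using run.Seq[OF t(2) u(2)] t(1) u(1)
    by (intro exI[of _ "t + u"]) auto
next
  case (If b c d)
  obtain t where t: "t \<le> ccost c" "run c s t (exec c s)" using If by fastforce
  obtain u where u: "u \<le> ccost d" "run d s u (exec d s)" using If by fastforce
  show ?case
  proof (cases "beval s b")
    case True
    then show ?thesis using run.IfTrue[OF True t(2)] t(1)
      by (intro exI[of _ "bcost b + t"]) auto
  next
    case False
    then show ?thesis using run.IfFalse[OF False u(2)] u(1)
      by (intro exI[of _ "bcost b + u"]) auto
  qed
next
  case (IAssign x es a)
  show ?case using run.IAssign[of x es a s] by auto
next
  case (RAssign x es a)
  show ?case using run.RAssign[of x es a s] by auto
next
  case Skip
  show ?case using run.Skip[of s] by auto
qed simp

lemma runs_straight: "straight c \<Longrightarrow> Q (exec c s) \<Longrightarrow> runs c s (ccost c) Q"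
  unfolding runs_def using run_straight by blast

text \<open>The invariant at \<open>k\<close> describes the memory in which \<open>k\<close> is
  about to be processed and the counter already holds \<open>k\<close>;
  \<open>lo \<le> hi + 1\<close> admits an empty range. Besides \<open>T\<close>, a pass pays for
  evaluating \<open>b\<close>, one comparison and one increment; the trailing
  \<open>icost b + 1\<close> is the failing test.\<close>

lemma runs_for:
  assumes x: "x \<notin> imods c"
    and lo: "ieval s a = lo" and le: "lo \<le> hi + 1"
    and hi: "\<And>s'. agree (insert x (imods c)) (rmods c) s s' \<Longrightarrow> ieval s' b = hi"
    and init: "J lo (iupdate x [] lo s)"
    and body: "\<And>k s'. lo \<le> k \<Longrightarrow> k \<le> hi \<Longrightarrow> agree (insert x (imods c)) (rmods c) s s' \<Longrightarrow>
      ints s' x [] = k \<Longrightarrow> J k s' \<Longrightarrow> runs c s' T (\<lambda>s''. J (Suc k) (iupdate x [] (Suc k) s''))"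
    and final: "\<And>s'. agree (insert x (imods c)) (rmods c) s s' \<Longrightarrow> J (Suc hi) s' \<Longrightarrow> Q s'"
  shows "runs (FOR x FROM a TO b DO c) s
    (icost a + ((hi + 1 - lo) * (T + icost b + 2) + icost b + 1)) Q"
proof -
  let ?A = "agree (insert x (imods c)) (rmods c) s"
  \<comment> \<open>The fuel \<open>d\<close> is the number of passes left; the frame is carried
    along so that \<open>b\<close> still evaluates to \<open>hi\<close>.\<close>
  let ?K = "\<lambda>d s'. \<exists>k. d = hi + 1 - k \<and> lo \<le> k \<and> k \<le> hi + 1 \<and> ?A s' \<and> ints s' x [] = k \<and> J k s'"
  let ?c = "c;; x [] :=\<^sub>i V x \<oplus>\<^sub>i N 1"
  have "runs (WHILE V x \<le>\<^sub>i b DO ?c) (iupdate x [] lo s)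
      ((hi + 1 - lo) * (T + 1 + bcost (V x \<le>\<^sub>i b)) + bcost (V x \<le>\<^sub>i b))
      (\<lambda>s'. (\<exists>d. ?K d s') \<and> \<not> beval s' (V x \<le>\<^sub>i b))"
  proof (rule runs_while)
    fix d s' assume "?K d s'" and b: "beval s' (V x \<le>\<^sub>i b)"
    then obtain k where k: "d = hi + 1 - k" "lo \<le> k" "?A s'" "ints s' x [] = k" "J k s'" by auto
    have "k \<le> hi" using b k(4) hi[OF k(3)] by simp
    have "runs ?c s' (T + 1) (?K (hi - k))"
    proof (rule runs_seq)
      show "runs c s' T (\<lambda>s''. J (Suc k) (iupdate x [] (Suc k) s''))"
        using body k \<open>k \<le> hi\<close> by blast
    next
      fix s'' assume ag: "agree (imods c) (rmods c) s' s''" and J: "J (Suc k) (iupdate x [] (Suc k) s'')"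
      have "ints s'' x [] = k" using agreeD(1)[OF ag x] k(4) by simp
      moreover have "?A s''" using agree_trans[OF k(3) agree_mono[OF ag]] by blast
      ultimately show "runs (x [] :=\<^sub>i V x \<oplus>\<^sub>i N 1) s'' 1 (?K (hi - k))"
        using runs_straight[of "x [] :=\<^sub>i V x \<oplus>\<^sub>i N 1" "?K (hi - k)" s''] J k(2) \<open>k \<le> hi\<close>
        by (auto simp: agree_iupdate intro!: exI[of _ "Suc k"])
    qed
    then show "\<exists>d'. d = Suc d' \<and> runs ?c s' (T + 1) (?K d')"
      using k(1) \<open>k \<le> hi\<close> by (intro exI[of _ "hi - k"]) auto
  next
    show "?K (hi + 1 - lo) (iupdate x [] lo s)"
      using init le by (intro exI[of _ lo]) (auto simp: agree_iupdate agree_refl)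
  qed
  then have "runs (WHILE V x \<le>\<^sub>i b DO ?c) (iupdate x [] lo s)
      ((hi + 1 - lo) * (T + icost b + 2) + icost b + 1) Q"
  proof (rule runs_mono, goal_cases)
    case (2 s')
    then obtain k where k: "k \<le> hi + 1" "?A s'" "ints s' x [] = k" "J k s'" by auto
    have "k = Suc hi" using k(1,3) 2 hi[OF k(2)] by auto
    then show ?case using final k by simp
  qed (auto simp: algebra_simps)
  then show ?thesis
    unfolding for_loop_def using lo
    by (intro runs_seq[where Q = "\<lambda>s'. s' = iupdate x [] lo s"])
      (use runs_straight[of "x [] :=\<^sub>i a"] in auto)
qed

text \<open>For a loop-free body the invariant step becomes a statement about \<open>exec\<close>,
  and all cost arithmetic is collected in one inequality.\<close>

lemma runs_for_straight:
  assumes "straight c" "x \<notin> imods c"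
    and "ieval s a = lo" "lo \<le> hi + 1"
    and "\<And>s'. agree (insert x (imods c)) (rmods c) s s' \<Longrightarrow> ieval s' b = hi"
    and "J lo (iupdate x [] lo s)"
    and "\<And>k s'. lo \<le> k \<Longrightarrow> k \<le> hi \<Longrightarrow> agree (insert x (imods c)) (rmods c) s s' \<Longrightarrow>
      ints s' x [] = k \<Longrightarrow> J k s' \<Longrightarrow> J (Suc k) (iupdate x [] (Suc k) (exec c s'))"
    and "\<And>s'. agree (insert x (imods c)) (rmods c) s s' \<Longrightarrow> J (Suc hi) s' \<Longrightarrow> Q s'"
    and "icost a + ((hi + 1 - lo) * (ccost c + icost b + 2) + icost b + 1) \<le> T"
  shows "runs (FOR x FROM a TO b DO c) s T Q"
proof -
  have body: "runs c s' (ccost c) (\<lambda>s''. J (Suc k) (iupdate x [] (Suc k) s''))"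
    if "lo \<le> k" "k \<le> hi" "agree (insert x (imods c)) (rmods c) s s'" "ints s' x [] = k" "J k s'"
    for k s'
    by (rule runs_straight[OF assms(1)], rule assms(7)[OF that])
  show ?thesis
    by (rule runs_mono[OF runs_for[of x c s a lo hi b J "ccost c" Q, OF assms(2-6) body assms(8)] assms(9)])
qed


section \<open>Potentials, matchings and alternating trees\<close>

definition feasible :: "nat \<Rightarrow> (nat \<Rightarrow> nat \<Rightarrow> real) \<Rightarrow> (nat \<Rightarrow> real) \<Rightarrow> (nat \<Rightarrow> real) \<Rightarrow> bool" where
  "feasible n z u v \<longleftrightarrow> (\<forall>r\<in>{1..n}. \<forall>c\<in>{1..n}. u r + v c \<le> z r c)"

text \<open>Column 0 is fictitious, so its edge need not be tight.\<close>

definition matching ::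
  "(nat \<Rightarrow> nat \<Rightarrow> real) \<Rightarrow> (nat \<Rightarrow> real) \<Rightarrow> (nat \<Rightarrow> real) \<Rightarrow> nat \<Rightarrow> nat set \<Rightarrow> (nat \<Rightarrow> nat) \<Rightarrow> bool" where
  "matching z u v i cols p \<longleftrightarrow>
     (\<forall>c\<in>cols. p c \<le> i) \<and>
     (\<forall>c\<in>cols. \<forall>d\<in>cols. p c \<noteq> 0 \<longrightarrow> p c = p d \<longrightarrow> c = d) \<and>
     {1..i} \<subseteq> p ` cols \<and>
     (\<forall>c\<in>cols. c \<noteq> 0 \<longrightarrow> p c \<noteq> 0 \<longrightarrow> u (p c) + v c = z (p c) c)"

section \<open>Alternating trees of tight edges\<close>

text \<open>
  The rank records the order in which columns entered the tree; it decreases along \<open>way\<close>,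
  which makes the augmenting path reach the root.
\<close>

definition way_rank ::
  "(nat \<Rightarrow> nat \<Rightarrow> real) \<Rightarrow> (nat \<Rightarrow> real) \<Rightarrow> (nat \<Rightarrow> real) \<Rightarrow> (nat \<Rightarrow> nat) \<Rightarrow> nat set \<Rightarrow> nat \<Rightarrow>
    (nat \<Rightarrow> nat) \<Rightarrow> (nat \<Rightarrow> nat) \<Rightarrow> bool" where
  "way_rank z u v p X j way rk \<longleftrightarrow>
     (\<forall>c\<in>X. rk c < card X) \<and> rk j = card X \<and>
     (\<forall>c\<in>insert j X. c \<noteq> 0 \<longrightarrow> way c \<in> X \<and> rk (way c) < rk c \<and>
        u (p (way c)) + v c = z (p (way c)) c)"

text \<open>\<open>X\<close> holds the columns already scanned, and \<open>j\<close> is the column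
  to be added next, reached by a tight edge unless it is the root. Before the first scan
  \<open>X\<close> is empty and \<open>j\<close> is the root; \<open>insert 0 X\<close> covers that
  stage, in which \<open>way\<close> is 0 and \<open>minv\<close> is measured from the row being
  inserted.\<close>

definition tree ::
  "nat \<Rightarrow> (nat \<Rightarrow> nat \<Rightarrow> real) \<Rightarrow> nat \<Rightarrow> (nat \<Rightarrow> nat) \<Rightarrow> (nat \<Rightarrow> real) \<Rightarrow> (nat \<Rightarrow> real) \<Rightarrow> nat set \<Rightarrow>
    nat \<Rightarrow> (nat \<Rightarrow> real) \<Rightarrow> (nat \<Rightarrow> nat) \<Rightarrow> bool" where
  "tree n z i p u v X j minv way \<longleftrightarrow>
     feasible n z u v \<and> matching z u v i {0..n} p \<and> 1 \<le> i \<and> i \<le> n \<and> p 0 = i \<and>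
     j \<le> n \<and> j \<notin> X \<and> X \<subseteq> {0..n} \<and> (0 \<in> X \<or> X = {} \<and> j = 0) \<and> (\<forall>c\<in>X. p c \<noteq> 0) \<and>
     (\<exists>rk. way_rank z u v p X j way rk) \<and>
     (\<forall>c\<in>{1..n} - X. way c \<in> insert 0 X \<and>
        minv c = z (p (way c)) c - u (p (way c)) - v c \<and>
        (\<forall>t\<in>X. minv c \<le> z (p t) c - u (p t) - v c))"

text \<open>Rows matched so far are at most \<open>i\<close>, so giving row \<open>Suc i\<close> to
  column 0 cannot clash with them, and column 0 is exempt from tightness: the potentials can stay as
  they are.\<close>

lemma tree_init:
  assumes "feasible n z u v" "matching z u v i {1..n} p" "Suc i \<le> n"
    and "\<And>c. c \<in> {1..n} \<Longrightarrow> q c = p c" "q 0 = Suc i"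
    and "\<And>c. c \<in> {1..n} \<Longrightarrow> way c = 0"
    and "\<And>c. c \<in> {1..n} \<Longrightarrow> minv c = z (Suc i) c - u (Suc i) - v c"
  shows "tree n z (Suc i) q u v {} 0 minv way"
proof -
  have q: "q c = (if c = 0 then Suc i else p c)" if "c \<in> {0..n}" for c
    using assms(4,5) that by auto
  have le: "p c \<le> i" if "c \<in> {0..n}" "c \<noteq> 0" for c
    using assms(2) that by (auto simp: matching_def)
  have "{1..Suc i} \<subseteq> q ` {0..n}"
  proof
    fix r assume r: "r \<in> {1..Suc i}"
    show "r \<in> q ` {0..n}"
    proof (cases "r = Suc i")
      case True
      then show ?thesis using assms(5) by force
    next
      case False
      then have "r \<in> p ` {1..n}" using r assms(2) by (auto simp: matching_def)
      then show ?thesis using assms(4) by force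
    qed
  qed
  moreover have "\<forall>c\<in>{0..n}. q c \<le> Suc i" using q le by (auto simp: le_Suc_eq)
  moreover have "\<forall>c\<in>{0..n}. \<forall>d\<in>{0..n}. q c \<noteq> 0 \<longrightarrow> q c = q d \<longrightarrow> c = d"
  proof (intro ballI impI)
    fix c d assume cd: "c \<in> {0..n}" "d \<in> {0..n}" "q c \<noteq> 0" "q c = q d"
    have eq: "(if c = 0 then Suc i else p c) = (if d = 0 then Suc i else p d)"
      using cd(4) q[OF cd(1)] q[OF cd(2)] by simp
    show "c = d"
    proof (cases "c = 0 \<or> d = 0")
      case True
      then show ?thesis using eq le[OF cd(1)] le[OF cd(2)] by (auto split: if_splits)
    next
      case False
      then have "c \<in> {1..n}" "d \<in> {1..n}" "p c \<noteq> 0" "p c = p d"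
        using cd eq q[OF cd(1)] by auto
      then show ?thesis using assms(2) unfolding matching_def by blast
    qed
  qed
  moreover have "\<forall>c\<in>{0..n}. c \<noteq> 0 \<longrightarrow> q c \<noteq> 0 \<longrightarrow> u (q c) + v c = z (q c) c"
    using assms(2) q by (auto simp: matching_def)
  ultimately have "matching z u v (Suc i) {0..n} q" by (simp add: matching_def)
  moreover have "way_rank z u v q {} 0 way (\<lambda>_. 0)" by (simp add: way_rank_def)
  ultimately show ?thesis using assms by (auto simp: tree_def)
qed

text \<open>Pigeonhole: otherwise all \<open>n + 1\<close> columns, the fictitious one included,
  would carry distinct rows out of \<open>n\<close>. This makes the minimum that defines the shift
  range over a nonempty set.\<close>

lemma tree_free_column:
  assumes tr: "tree n z i p u v X j minv way" and "p j \<noteq> 0"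
  shows "\<exists>c\<in>{1..n}. c \<notin> insert j X"
proof (rule ccontr)
  assume "\<not> ?thesis"
  then have sub: "{1..n} \<subseteq> insert j X" by blast
  have "0 \<in> insert j X" using tr by (auto simp: tree_def)
  moreover have "{0..n} = insert 0 {1..n}" by auto
  ultimately have "{0..n} \<subseteq> insert j X" using sub by (metis insert_subset)
  moreover have "\<forall>c\<in>X. p c \<noteq> 0" using tr by (simp add: tree_def)
  ultimately have all: "p c \<noteq> 0" if "c \<in> {0..n}" for c
    using assms(2) that by blast
  have mat: "matching z u v i {0..n} p" using tr by (simp add: tree_def)
  have "inj_on p {0..n}"
  proof (rule inj_onI)
    fix c d assume "c \<in> {0..n}" "d \<in> {0..n}" "p c = p d"
    then show "c = d" using mat all[of c] unfolding matching_def by blast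
  qed
  moreover have "p ` {0..n} \<subseteq> {1..n}"
  proof
    fix r assume "r \<in> p ` {0..n}"
    then obtain c where c: "c \<in> {0..n}" "r = p c" by blast
    then have "p c \<le> i" using mat unfolding matching_def by blast
    then show "r \<in> {1..n}" using c all[of c] tr by (auto simp: tree_def)
  qed
  ultimately have "card {0..n} \<le> card {1..n}" by (intro card_inj_on_le) auto
  then show False by simp
qed

text \<open>Adding \<open>d\<close> to the tree rows and subtracting it from the tree columns
  cancels on edges inside the tree, only loosens edges from outside rows to tree columns, and
  consumes at most the slack of edges leaving the tree. The edge attaining the minimum, the one
  towards \<open>j1\<close>, becomes tight.\<close>

lemma tree_step:
  assumes tr: "tree n z i p u v X j minv way" and pj: "p j \<noteq> 0"
    and F: "F = {1..n} - insert j X"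
    and minv1: "\<And>c. c \<in> F \<Longrightarrow> minv1 c = min (minv c) (z (p j) c - u (p j) - v c)"
    and way1: "\<And>c. way1 c = (if c \<in> F \<and> z (p j) c - u (p j) - v c < minv c then j else way c)"
    and j1: "j1 \<in> F" and d: "d = minv1 j1" and dmin: "\<And>c. c \<in> F \<Longrightarrow> d \<le> minv1 c"
    and u1: "\<And>r. u1 r = (if r \<in> p ` insert j X then u r + d else u r)"
    and v1: "\<And>c. v1 c = (if c \<in> insert j X then v c - d else v c)"
    and minv2: "\<And>c. c \<in> F \<Longrightarrow> minv2 c = minv1 c - d"
  shows "tree n z i p u1 v1 (insert j X) j1 minv2 way1"
proof -
  let ?Y = "insert j X"
  have feas: "feasible n z u v" and mat: "matching z u v i {0..n} p" and i: "1 \<le> i" "i \<le> n"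
    and p0: "p 0 = i" and jn: "j \<le> n" and jX: "j \<notin> X" and Xn: "X \<subseteq> {0..n}"
    and root: "0 \<in> X \<or> X = {} \<and> j = 0" and pX: "\<forall>c\<in>X. p c \<noteq> 0"
    and out: "\<forall>c\<in>{1..n} - X. way c \<in> insert 0 X \<and>
        minv c = z (p (way c)) c - u (p (way c)) - v c \<and>
        (\<forall>t\<in>X. minv c \<le> z (p t) c - u (p t) - v c)"
    using tr unfolding tree_def by blast+
  obtain rk where rk: "way_rank z u v p X j way rk" using tr by (auto simp: tree_def)
  have fin: "finite X" using Xn finite_subset by blast
  have cY: "card ?Y = Suc (card X)" using fin jX by simp
  have Yn: "?Y \<subseteq> {0..n}" using Xn jn by auto
  have pY: "p c \<in> {1..n}" if "c \<in> ?Y" for c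
  proof -
    have "p c \<le> i" using mat Yn that unfolding matching_def by blast
    moreover have "p c \<noteq> 0" using pX pj that by blast
    ultimately show ?thesis using i by auto
  qed
  have 0: "0 \<in> ?Y" using root by auto
  have uY: "u1 (p c) = u (p c) + d" if "c \<in> ?Y" for c using u1 that by auto
  \<comment> \<open>A matched edge outside the tree changes at neither end: by injectivity its row
    belongs to no tree column.\<close>
  have unY: "u1 (p c) = u (p c)" if "c \<in> {0..n}" "c \<notin> ?Y" "p c \<noteq> 0" for c
  proof -
    have "p c \<notin> p ` ?Y"
    proof
      assume "p c \<in> p ` ?Y"
      then obtain t where "t \<in> ?Y" "p c = p t" by blast
      moreover have "t \<in> {0..n}" using \<open>t \<in> ?Y\<close> Yn by blast
      ultimately have "c = t" using mat that unfolding matching_def by blast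
      then show False using that \<open>t \<in> ?Y\<close> by blast
    qed
    then show ?thesis using u1 by simp
  qed
  \<comment> \<open>For the empty tree \<open>way c\<close> is 0, which is then \<open>j\<close>
    itself, so the tail of the edge lies in \<open>insert j X\<close> from the first step
    on.\<close>
  have wF: "way1 c \<in> ?Y \<and> minv1 c = z (p (way1 c)) c - u (p (way1 c)) - v c" if "c \<in> F" for c
  proof -
    have "c \<in> {1..n} - X" using that F by auto
    then have "way c \<in> insert 0 X" and w: "minv c = z (p (way c)) c - u (p (way c)) - v c"
      using out by blast+
    then have "way c \<in> ?Y" using 0 by (metis insert_iff)
    then show ?thesis using way1[of c] minv1[OF that] that w by auto
  qed
  have mF: "minv1 c \<le> z (p t) c - u (p t) - v c" if "c \<in> F" "t \<in> ?Y" for c t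
  proof (cases "t = j")
    case True
    then show ?thesis using minv1[OF that(1)] by simp
  next
    case False
    then have "t \<in> X" "c \<in> {1..n} - X" using that F by auto
    then have "minv c \<le> z (p t) c - u (p t) - v c" using out by blast
    then show ?thesis using minv1[OF that(1)] by simp
  qed
  \<comment> \<open>\<open>d\<close> is the reduced cost of a genuine edge, so feasibility gives the
    sign. The sign matters where a tree column is lowered but the row is not raised.\<close>
  have d0: "0 \<le> d"
  proof -
    have "p (way1 j1) \<in> {1..n}" "j1 \<in> {1..n}" using wF[OF j1] pY j1 F by auto
    then have "u (p (way1 j1)) + v j1 \<le> z (p (way1 j1)) j1" using feas by (simp add: feasible_def)
    then show ?thesis using wF[OF j1] d by simp
  qed
  have "feasible n z u1 v1" unfolding feasible_def
  proof (intro ballI)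
    fix r c assume rc: "r \<in> {1..n}" "c \<in> {1..n}"
    have f: "u r + v c \<le> z r c" using feas rc by (simp add: feasible_def)
    show "u1 r + v1 c \<le> z r c"
    proof (cases "r \<in> p ` ?Y \<and> c \<notin> ?Y")
      case True
      then obtain t where t: "t \<in> ?Y" "r = p t" by blast
      have "c \<in> F" using True rc F by auto
      then have "d \<le> z (p t) c - u (p t) - v c" using dmin mF t by (meson order_trans)
      then show ?thesis using u1[of r] v1[of c] True t by auto
    next
      case False
      then show ?thesis using u1[of r] v1[of c] f d0 by auto
    qed
  qed
  moreover have "matching z u1 v1 i {0..n} p"
  proof -
    have "u1 (p c) + v1 c = z (p c) c" if c: "c \<in> {0..n}" "c \<noteq> 0" "p c \<noteq> 0" for c
    proof -
      have "u (p c) + v c = z (p c) c" using mat c unfolding matching_def by blast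
      then show ?thesis using uY[of c] unY[of c] v1[of c] c by (cases "c \<in> ?Y") auto
    qed
    then show ?thesis using mat unfolding matching_def by blast
  qed
  \<comment> \<open>The rank \<open>card ?Y\<close> exceeds that of every tree column; the largest
    so far is that of \<open>j\<close>, equal to \<open>card X\<close>.\<close>
  moreover have "way_rank z u1 v1 p ?Y j1 way1 (rk(j1 := card ?Y))"
  proof -
    have j1Y: "j1 \<notin> ?Y" using j1 F by blast
    have less: "rk c < card ?Y" if "c \<in> ?Y" for c
      using rk that cY unfolding way_rank_def by (cases "c = j") (auto simp: less_Suc_eq)
    have "way1 c \<in> ?Y \<and> (rk(j1 := card ?Y)) (way1 c) < (rk(j1 := card ?Y)) c \<and>
        u1 (p (way1 c)) + v1 c = z (p (way1 c)) c" if c: "c \<in> insert j1 ?Y" "c \<noteq> 0" for c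
    proof (cases "c = j1")
      case True
      then show ?thesis
        using wF[OF j1] less[of "way1 j1"] j1Y uY[of "way1 j1"] v1[of j1] d by auto
    next
      case False
      then have cY: "c \<in> ?Y" using c by blast
      \<comment> \<open>Only columns outside the tree have \<open>way\<close> overwritten, and the
        two ends of an old tree edge shift by opposite amounts.\<close>
      then have w: "way1 c = way c" using way1 F by auto
      have "way c \<in> X \<and> rk (way c) < rk c \<and> u (p (way c)) + v c = z (p (way c)) c"
        using rk cY c(2) unfolding way_rank_def by blast
      then show ?thesis using w False j1Y uY[of "way c"] v1[of c] cY by auto
    qed
    then show ?thesis using less j1Y unfolding way_rank_def by auto
  qed
  moreover have "\<forall>c\<in>{1..n} - ?Y. way1 c \<in> insert 0 ?Y \<and>
        minv2 c = z (p (way1 c)) c - u1 (p (way1 c)) - v1 c \<and>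
        (\<forall>t\<in>?Y. minv2 c \<le> z (p t) c - u1 (p t) - v1 c)"
  proof (intro ballI conjI)
    fix c assume c: "c \<in> {1..n} - ?Y"
    then have cF: "c \<in> F" using F by simp
    show "way1 c \<in> insert 0 ?Y" using wF[OF cF] by blast
    show "minv2 c = z (p (way1 c)) c - u1 (p (way1 c)) - v1 c"
      using wF[OF cF] uY[of "way1 c"] minv2[OF cF] v1[of c] c by auto
    fix t assume t: "t \<in> ?Y"
    show "minv2 c \<le> z (p t) c - u1 (p t) - v1 c"
      using mF[OF cF t] uY[OF t] minv2[OF cF] v1[of c] c by auto
  qed
  moreover have "j1 \<le> n" "j1 \<notin> ?Y" using j1 F by auto
  moreover have "\<forall>c\<in>?Y. p c \<noteq> 0" using pX pj by blast
  ultimately show ?thesis using i p0 Yn 0 unfolding tree_def by blast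
qed

section \<open>Flipping the augmenting path\<close>

text \<open>
  While the matching is flipped along the path, the row of column \<open>j\<close> has already been moved
  away; below \<open>j\<close> the path is still intact.
\<close>

definition flipping ::
  "nat \<Rightarrow> (nat \<Rightarrow> nat \<Rightarrow> real) \<Rightarrow> (nat \<Rightarrow> real) \<Rightarrow> (nat \<Rightarrow> real) \<Rightarrow> nat \<Rightarrow> nat set \<Rightarrow> (nat \<Rightarrow> nat) \<Rightarrow>
    (nat \<Rightarrow> nat) \<Rightarrow> (nat \<Rightarrow> nat) \<Rightarrow> nat \<Rightarrow> bool" where
  "flipping n z u v i X way rk p j \<longleftrightarrow>
     matching z u v i ({0..n} - {j}) p \<and> j \<in> X \<and> X \<subseteq> {0..n} \<and>
     (\<forall>c\<in>X. c \<noteq> 0 \<longrightarrow> rk c \<le> rk j \<longrightarrow> way c \<in> X \<and> rk (way c) < rk c \<and> p (way c) \<noteq> 0 \<and>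
        u (p (way c)) + v c = z (p (way c)) c)"

text \<open>Column \<open>j\<close> carries no row, so leaving it out of the matching loses none.
  Its rank is \<open>card X\<close>, at most \<open>n\<close> because \<open>j\<close> lies outside
  \<open>X\<close>; this will bound the number of flips.\<close>

lemma flipping_init:
  assumes tr: "tree n z i p u v X j minv way" and pj: "p j = 0"
  obtains rk where "flipping n z u v i (insert j X) way rk p j" "rk j \<le> n"
proof -
  obtain rk where rk: "way_rank z u v p X j way rk" using tr by (auto simp: tree_def)
  have mat: "matching z u v i {0..n} p" using tr by (simp add: tree_def)
  have "{1..i} \<subseteq> p ` ({0..n} - {j})"
  proof
    fix r assume r: "r \<in> {1..i}"
    then obtain c where "c \<in> {0..n}" "r = p c" using mat unfolding matching_def by blast
    then show "r \<in> p ` ({0..n} - {j})" using r pj by auto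
  qed
  then have "matching z u v i ({0..n} - {j}) p" using mat by (simp add: matching_def)
  moreover have "card X \<le> n"
  proof -
    have "card X < card {0..n}" using tr by (intro psubset_card_mono) (auto simp: tree_def)
    then show ?thesis by simp
  qed
  moreover have sub: "\<forall>c\<in>X. p c \<noteq> 0" "insert j X \<subseteq> {0..n}" using tr by (auto simp: tree_def)
  moreover have "rk j \<le> n" using rk \<open>card X \<le> n\<close> by (simp add: way_rank_def)
  moreover have "way c \<in> insert j X \<and> rk (way c) < rk c \<and> p (way c) \<noteq> 0 \<and>
        u (p (way c)) + v c = z (p (way c)) c" if "c \<in> insert j X" "c \<noteq> 0" for c
  proof -
    have "way c \<in> X \<and> rk (way c) < rk c \<and> u (p (way c)) + v c = z (p (way c)) c"
      using rk that unfolding way_rank_def by blast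
    then show ?thesis using sub(1) by blast
  qed
  ultimately show thesis using that[of rk] unfolding flipping_def by simp
qed

text \<open>The row of \<open>way j\<close> moves over to \<open>j\<close> along a tight edge, so
  \<open>way j\<close> becomes the vacant column. Ranks fall strictly along the path, hence no later
  step reads the entry just overwritten.\<close>

lemma flipping_step:
  assumes fl: "flipping n z u v i X way rk p j" and j: "j \<noteq> 0"
  shows "flipping n z u v i X way rk (p(j := p (way j))) (way j)" "rk (way j) < rk j"
proof -
  let ?k = "way j"
  have mat: "matching z u v i ({0..n} - {j}) p" and jX: "j \<in> X" and X: "X \<subseteq> {0..n}"
    and path: "\<And>c. c \<in> X \<Longrightarrow> c \<noteq> 0 \<Longrightarrow> rk c \<le> rk j \<Longrightarrow> way c \<in> X \<and> rk (way c) < rk c \<and> p (way c) \<noteq> 0 \<and>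
        u (p (way c)) + v c = z (p (way c)) c"
    using fl by (auto simp: flipping_def)
  have k: "?k \<in> X" "rk ?k < rk j" "p ?k \<noteq> 0" "u (p ?k) + v j = z (p ?k) j"
    using path[OF jX j] by auto
  show "rk (way j) < rk j" by (fact k(2))
  have kj: "?k \<noteq> j" using k(2) by auto
  have kn: "?k \<in> {0..n} - {j}" using k(1) X kj by auto
  have inj: "c \<in> {0..n} - {j} \<Longrightarrow> d \<in> {0..n} - {j} \<Longrightarrow> p c \<noteq> 0 \<Longrightarrow> p c = p d \<Longrightarrow> c = d" for c d
    using mat unfolding matching_def by blast
  have "matching z u v i ({0..n} - {?k}) (p(j := p ?k))"
  proof -
    have le: "\<forall>c\<in>{0..n} - {j}. p c \<le> i" using mat by (simp add: matching_def)
    have "\<forall>c\<in>{0..n} - {?k}. (p(j := p ?k)) c \<le> i" using le kn by auto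
    moreover have "c = d" if cd: "c \<in> {0..n} - {?k}" "d \<in> {0..n} - {?k}"
      "(p(j := p ?k)) c \<noteq> 0" "(p(j := p ?k)) c = (p(j := p ?k)) d" for c d
    proof -
      consider "c = j" "d = j" | "c = j" "d \<noteq> j" | "c \<noteq> j" "d = j" | "c \<noteq> j" "d \<noteq> j" by blast
      then show ?thesis
      proof cases
        case 2
        then have "p ?k = p d" "d \<in> {0..n} - {j}" using cd by auto
        then show ?thesis using inj[OF kn] k(3) cd(2) by blast
      next
        case 3
        then have "p ?k = p c" "c \<in> {0..n} - {j}" using cd by auto
        then show ?thesis using inj[OF kn] k(3) cd(1) by blast
      next
        case 4
        then have "p c \<noteq> 0" "p c = p d" "c \<in> {0..n} - {j}" "d \<in> {0..n} - {j}" using cd by auto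
        then show ?thesis using inj by blast
      qed simp
    qed
    moreover have "{1..i} \<subseteq> (p(j := p ?k)) ` ({0..n} - {?k})"
    proof
      fix r assume "r \<in> {1..i}"
      then obtain c where c: "c \<in> {0..n} - {j}" "r = p c" using mat unfolding matching_def by blast
      \<comment> \<open>The row that sat in column \<open>way j\<close> is now found in column
        \<open>j\<close>; every other row stays where it was.\<close>
      let ?c = "if c = ?k then j else c"
      have "r = (p(j := p ?k)) ?c" "?c \<in> {0..n} - {?k}" using c kj jX X by auto
      then show "r \<in> (p(j := p ?k)) ` ({0..n} - {?k})" by blast
    qed
    moreover have "\<forall>c\<in>{0..n} - {j}. c \<noteq> 0 \<longrightarrow> p c \<noteq> 0 \<longrightarrow> u (p c) + v c = z (p c) c"
      using mat unfolding matching_def by blast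
    ultimately show ?thesis using k(4) unfolding matching_def by auto
  qed
  moreover have "way c \<in> X \<and> rk (way c) < rk c \<and> (p(j := p ?k)) (way c) \<noteq> 0 \<and>
        u ((p(j := p ?k)) (way c)) + v c = z ((p(j := p ?k)) (way c)) c"
    if c: "c \<in> X" "c \<noteq> 0" "rk c \<le> rk ?k" for c
  proof -
    have "way c \<noteq> j" using path[OF c(1,2)] c(3) k(2) by auto
    then show ?thesis using path[OF c(1,2)] c(3) k(2) by auto
  qed
  ultimately show "flipping n z u v i X way rk (p(j := p (way j))) (way j)"
    using k(1) X by (simp add: flipping_def)
qed

section \<open>Perfect matchings and weak duality\<close>

lemma perfect_matching_bij:
  assumes "matching z u v n {1..n} p"
  shows "bij_betw p {1..n} {1..n}"
proof -
  have sub: "{1..n} \<subseteq> p ` {1..n}" using assms by (simp add: matching_def)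
  have "card (p ` {1..n}) \<le> card {1..n}" by (rule card_image_le) simp
  then have eq: "p ` {1..n} = {1..n}" using sub
    by (metis card_seteq finite_atLeastAtMost finite_imageI)
  then show ?thesis by (simp add: bij_betw_def eq_card_imp_inj_on)
qed

text \<open>Weak duality: the potentials bound every assignment, and tight edges attain the bound.\<close>

lemma perfect_matching_optimal:
  assumes "feasible n z u v" "matching z u v n {1..n} p"
    and \<sigma>: "\<And>c. c \<in> {1..n} \<Longrightarrow> \<sigma> (p c) = c" and \<tau>: "\<tau> permutes {1..n}"
  shows "(\<Sum>r = 1..n. z r (\<sigma> r)) \<le> (\<Sum>r = 1..n. z r (\<tau> r))"
proof -
  have bij: "bij_betw p {1..n} {1..n}" using assms(2) by (rule perfect_matching_bij)
  have "(\<Sum>r = 1..n. z r (\<sigma> r)) = (\<Sum>c = 1..n. z (p c) (\<sigma> (p c)))"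
    by (rule sum.reindex_bij_betw[OF bij, symmetric])
  also have "\<dots> = (\<Sum>c = 1..n. u (p c) + v c)"
  proof (rule sum.cong[OF refl])
    fix c assume c: "c \<in> {1..n}"
    then have "p c \<in> {1..n}" using bij by (auto simp: bij_betw_def)
    then show "z (p c) (\<sigma> (p c)) = u (p c) + v c"
      using assms(2) c \<sigma>[OF c] by (auto simp: matching_def)
  qed
  also have "\<dots> = (\<Sum>r = 1..n. u r) + (\<Sum>c = 1..n. v c)"
    using sum.reindex_bij_betw[OF bij, of u] by (simp add: sum.distrib)
  also have "\<dots> = (\<Sum>r = 1..n. u r + v (\<tau> r))"
    using sum.permute[OF \<tau>, of v] by (simp add: sum.distrib comp_def)
  also have "\<dots> \<le> (\<Sum>r = 1..n. z r (\<tau> r))"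
    using assms(1) permutes_in_image[OF \<tau>] by (intro sum_mono) (auto simp: feasible_def)
  finally show ?thesis .
qed

section \<open>The Hungarian algorithm\<close>

definition reduced :: "memory \<Rightarrow> nat \<Rightarrow> nat \<Rightarrow> real" where
  "reduced s r c = reals s ''z'' [r, c] - reals s ''u'' [r] - reals s ''v'' [c]"

text \<open>With the set of treated columns as a parameter, one formula serves both as loop
  invariant and as postcondition. The value 0 of \<open>j1\<close> encodes that there is no
  candidate yet.\<close>

definition scanned :: "nat set \<Rightarrow> memory \<Rightarrow> memory \<Rightarrow> bool" where
  "scanned A s s' \<longleftrightarrow>
     (\<forall>c. ints s' ''way'' [c] =
        (if c \<in> A \<and> reduced s (ints s ''i0'' []) c < reals s ''minv'' [c] then ints s ''j0'' []
         else ints s ''way'' [c])) \<and>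
     (\<forall>c. reals s' ''minv'' [c] =
        (if c \<in> A then min (reals s ''minv'' [c]) (reduced s (ints s ''i0'' []) c)
         else reals s ''minv'' [c])) \<and>
     (if A = {} then ints s' ''j1'' [] = 0
      else ints s' ''j1'' [] \<in> A \<and> reals s' ''delta'' [] = reals s' ''minv'' [ints s' ''j1'' []] \<and>
        (\<forall>c\<in>A. reals s' ''delta'' [] \<le> reals s' ''minv'' [c]))"

definition scan_column :: com where
  "scan_column =
    (''cur'' [] :=\<^sub>r R ''z'' [V ''i0'', V ''j''] \<ominus>\<^sub>r R ''u'' [V ''i0''] \<ominus>\<^sub>r R ''v'' [V ''j''];;
     IF R ''cur'' [] <\<^sub>r R ''minv'' [V ''j'']
     THEN (''minv'' [V ''j''] :=\<^sub>r R ''cur'' [];; ''way'' [V ''j''] :=\<^sub>i V ''j0'')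
     ELSE SKIP;;
     IF V ''j1'' =\<^sub>i N 0
     THEN (''delta'' [] :=\<^sub>r R ''minv'' [V ''j''];; ''j1'' [] :=\<^sub>i V ''j'')
     ELSE IF R ''minv'' [V ''j''] <\<^sub>r R ''delta'' []
     THEN (''delta'' [] :=\<^sub>r R ''minv'' [V ''j''];; ''j1'' [] :=\<^sub>i V ''j'')
     ELSE SKIP)"

text \<open>The treated column is new, so its \<open>minv\<close> entry is still the initial one and
  the entries for \<open>A\<close> are untouched; a single comparison then updates the running
  minimum.\<close>

lemma scanned_insert:
  assumes sc: "scanned A s s'" and "k \<notin> A" "0 \<notin> A" and k: "ints s' ''j'' [] = k"
    and eqs: "ints s' ''i0'' = ints s ''i0''" "ints s' ''j0'' = ints s ''j0''"
      "reals s' ''z'' = reals s ''z''" "reals s' ''u'' = reals s ''u''" "reals s' ''v'' = reals s ''v''"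
  shows "scanned (insert k A) s (exec scan_column s')"
proof -
  let ?i = "ints s ''i0'' []"
  \<comment> \<open>The memory after \<open>minv\<close> and \<open>way\<close> have been updated,
    before the candidate for the minimum is revised.\<close>
  define s1 where "s1 = (if reduced s ?i k < reals s ''minv'' [k]
    then iupdate ''way'' [k] (ints s ''j0'' []) (rupdate ''minv'' [k] (reduced s ?i k)
      (rupdate ''cur'' [] (reduced s ?i k) s'))
    else rupdate ''cur'' [] (reduced s ?i k) s')"
  have way: "ints s1 ''way'' [c] =
      (if c \<in> insert k A \<and> reduced s ?i c < reals s ''minv'' [c] then ints s ''j0'' []
         else ints s ''way'' [c])" for c
    using sc \<open>k \<notin> A\<close> by (auto simp: s1_def scanned_def)
  have minv: "reals s1 ''minv'' [c] =
      (if c \<in> insert k A then min (reals s ''minv'' [c]) (reduced s ?i c) else reals s ''minv'' [c])" for c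
    using sc \<open>k \<notin> A\<close> by (auto simp: s1_def scanned_def)
  have same: "reals s1 ''minv'' [c] = reals s' ''minv'' [c]" if "c \<in> A" for c
    using that \<open>k \<notin> A\<close> by (auto simp: s1_def)
  have s1: "ints s1 ''j1'' [] = ints s' ''j1'' []" "reals s1 ''delta'' [] = reals s' ''delta'' []"
    "ints s1 ''j'' [] = k" using k by (auto simp: s1_def)
  have best: "if A = {} then ints s1 ''j1'' [] = 0
      else ints s1 ''j1'' [] \<in> A \<and> reals s1 ''delta'' [] = reals s1 ''minv'' [ints s1 ''j1'' []] \<and>
        (\<forall>c\<in>A. reals s1 ''delta'' [] \<le> reals s1 ''minv'' [c])"
    using sc same unfolding s1 scanned_def by (auto split: if_splits)
  \<comment> \<open>Since 0 is never a treated column, the program's test on \<open>j1\<close>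
    recognises exactly the first one.\<close>
  have zero: "ints s1 ''j1'' [] = 0 \<longleftrightarrow> A = {}"
    using best \<open>0 \<notin> A\<close> by (auto split: if_splits)
  have mk: "reals s' ''minv'' [k] = reals s ''minv'' [k]" using sc \<open>k \<notin> A\<close> by (simp add: scanned_def)
  let ?d = "IF V ''j1'' =\<^sub>i N 0
     THEN (''delta'' [] :=\<^sub>r R ''minv'' [V ''j''];; ''j1'' [] :=\<^sub>i V ''j'')
     ELSE IF R ''minv'' [V ''j''] <\<^sub>r R ''delta'' []
     THEN (''delta'' [] :=\<^sub>r R ''minv'' [V ''j''];; ''j1'' [] :=\<^sub>i V ''j'')
     ELSE SKIP"
  have "exec scan_column s' = exec ?d s1"
    by (simp add: scan_column_def s1_def k eqs mk reduced_def)
  also have "exec ?d s1 =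
    (if A = {} \<or> reals s1 ''minv'' [k] < reals s1 ''delta'' []
     then iupdate ''j1'' [] k (rupdate ''delta'' [] (reals s1 ''minv'' [k]) s1) else s1)"
    by (simp add: zero s1(3))
  also have "scanned (insert k A) s \<dots>"
    using best unfolding scanned_def by (auto simp: way minv split: if_splits)
  finally show ?thesis .
qed

text \<open>The loop leaves \<open>used\<close> alone, so \<open>F\<close> can be fixed at the
  start, and its initial segments give the invariant.\<close>

lemma scan_columns_spec:
  assumes n: "ints s ''n'' [] = n"
    and F: "F = {c \<in> {1..n}. ints s ''used'' [c] = 0}"
  shows "runs scan_columns s (12 * (n + 1)) (scanned F s)"
proof -
  let ?J = "\<lambda>k. scanned {c \<in> F. c < k} s"
  have eq: "scan_columns = (''j1'' [] :=\<^sub>i N 0;;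
      FOR ''j'' FROM N 1 TO V ''n'' DO IF I ''used'' [V ''j''] =\<^sub>i N 0 THEN scan_column ELSE SKIP)"
    by (simp add: scan_columns_def scan_column_def)
  have sc: "straight scan_column" "imods scan_column = {''way'', ''j1''}"
    "rmods scan_column = {''cur'', ''minv'', ''delta''}" "ccost scan_column = 5"
    by (auto simp: scan_column_def)
  have "runs scan_columns s (0 + 12 * (n + 1)) (?J (Suc n))"
    unfolding eq
  proof (rule runs_seq[where Q = "\<lambda>s'. s' = iupdate ''j1'' [] 0 s"])
    show "runs (''j1'' [] :=\<^sub>i N 0) s 0 (\<lambda>s'. s' = iupdate ''j1'' [] 0 s)"
      using runs_straight[of "''j1'' [] :=\<^sub>i N 0" "\<lambda>s'. s' = iupdate ''j1'' [] 0 s" s] by simp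
  next
    fix s1 assume "s1 = iupdate ''j1'' [] 0 s"
    then show "runs (FOR ''j'' FROM N 1 TO V ''n'' DO
        IF I ''used'' [V ''j''] =\<^sub>i N 0 THEN scan_column ELSE SKIP) s1 (12 * (n + 1)) (?J (Suc n))"
    proof (intro runs_for_straight[where J = ?J and lo = 1 and hi = n], goal_cases)
      case (5 s')
      have "ints s' ''n'' = ints s1 ''n''" by (rule agreeD(1)[OF 5(2)]) (simp add: sc)
      then show ?case using n 5(1) by simp
    next
      case 6
      have G1: "{c \<in> F. c < 1} = {}" using F by auto
      show ?case unfolding G1 using 6 by (simp add: scanned_def)
    next
      case (7 k s')
      have eqs: "ints s' ''used'' = ints s ''used''" "ints s' ''i0'' = ints s ''i0''"
        "ints s' ''j0'' = ints s ''j0''" "reals s' ''z'' = reals s ''z''"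
        "reals s' ''u'' = reals s ''u''" "reals s' ''v'' = reals s ''v''"
        using agreeD[OF 7(4)] 7(1) by (auto simp: sc fun_eq_iff)
      have j: "scanned A s (iupdate ''j'' [] x t) \<longleftrightarrow> scanned A s t" for A x t
        by (simp add: scanned_def)
      show ?case
      proof (cases "ints s ''used'' [k] = 0")
        case False
        then have "k \<notin> F" using F by simp
        then have G: "{c \<in> F. c < Suc k} = {c \<in> F. c < k}" by (auto simp: less_Suc_eq)
        show ?thesis unfolding G j using 7(6) False eqs 7(5) by simp
      next
        case True
        then have kF: "k \<in> F" using F 7(2,3) by simp
        then have G: "{c \<in> F. c < Suc k} = insert k {c \<in> F. c < k}" by (auto simp: less_Suc_eq)
        show ?thesis unfolding G j
          using scanned_insert[OF 7(6) _ _ 7(5) eqs(2-6)] True eqs(1) 7(5) F by simp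
      qed
    qed (simp_all add: sc)
  qed
  moreover have "{c \<in> F. c < Suc n} = F" using F by auto
  ultimately show ?thesis by simp
qed

text \<open>Injectivity of the matching on the tree is essential: two tree columns sharing a row
  would raise its \<open>u\<close> twice.\<close>

lemma update_potentials_spec:
  assumes n: "ints s ''n'' [] = n"
    and X: "\<And>c. c \<in> {0..n} \<Longrightarrow> ints s ''used'' [c] = (if c \<in> X then 1 else 0)" "X \<subseteq> {0..n}"
    and inj: "inj_on (\<lambda>c. ints s ''p'' [c]) X"
  shows "runs update_potentials s (10 * (n + 1)) (\<lambda>s'.
    (\<forall>r. reals s' ''u'' [r] = (if r \<in> (\<lambda>c. ints s ''p'' [c]) ` X
       then reals s ''u'' [r] + reals s ''delta'' [] else reals s ''u'' [r])) \<and>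
    (\<forall>c. reals s' ''v'' [c] = (if c \<in> X
       then reals s ''v'' [c] - reals s ''delta'' [] else reals s ''v'' [c])) \<and>
    (\<forall>c\<in>{0..n} - X. reals s' ''minv'' [c] = reals s ''minv'' [c] - reals s ''delta'' []))"
    (is "runs _ _ _ ?Q")
proof -
  let ?p = "\<lambda>c. ints s ''p'' [c]"
  let ?J = "\<lambda>k s'.
    (\<forall>r. reals s' ''u'' [r] = (if r \<in> ?p ` {c \<in> X. c < k}
       then reals s ''u'' [r] + reals s ''delta'' [] else reals s ''u'' [r])) \<and>
    (\<forall>c. reals s' ''v'' [c] = (if c \<in> {c \<in> X. c < k}
       then reals s ''v'' [c] - reals s ''delta'' [] else reals s ''v'' [c])) \<and>
    (\<forall>c. reals s' ''minv'' [c] = (if c < k \<and> c \<notin> X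
       then reals s ''minv'' [c] - reals s ''delta'' [] else reals s ''minv'' [c]))"
  show ?thesis unfolding update_potentials_def
  proof (rule runs_for_straight[where J = ?J and lo = 0 and hi = n], goal_cases)
    case (5 s')
    have "ints s' ''n'' = ints s ''n''" by (rule agreeD(1)[OF 5]) simp
    then show ?case using n by simp
  next
    case (7 k s')
    have eqs: "ints s' ''used'' = ints s ''used''" "ints s' ''p'' = ints s ''p''"
      "reals s' ''delta'' = reals s ''delta''"
      using agreeD[OF 7(3)] by auto
    show ?case
    proof (cases "k \<in> X")
      case False
      then have G: "{c \<in> X. c < Suc k} = {c \<in> X. c < k}" by (auto simp: less_Suc_eq)
      have "ints s ''used'' [k] = 0" using False X 7(2) by simp
      moreover have "(c < Suc k \<and> c \<notin> X) = (c = k \<or> c < k \<and> c \<notin> X)" for c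
        using False by (auto simp: less_Suc_eq)
      ultimately show ?thesis unfolding G using 7(4,5) eqs False by simp
    next
      case True
      then have G: "{c \<in> X. c < Suc k} = insert k {c \<in> X. c < k}" by (auto simp: less_Suc_eq)
      have pk: "?p k \<notin> ?p ` {c \<in> X. c < k}"
      proof
        assume "?p k \<in> ?p ` {c \<in> X. c < k}"
        then obtain c where c: "c \<in> X" "c < k" "?p k = ?p c" by blast
        then have "k = c" using inj_onD[OF inj c(3) True c(1)] by simp
        then show False using c(2) by simp
      qed
      have "ints s ''used'' [k] = 1" using True X 7(2) by simp
      moreover have "(c < Suc k \<and> c \<notin> X) = (c < k \<and> c \<notin> X)" for c
        using True by (auto simp: less_Suc_eq)
      moreover define B where "B = ?p ` {c \<in> X. c < k}"
      moreover have "?p ` {c \<in> X. c < Suc k} = insert (?p k) B" unfolding G B_def by simp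
      ultimately show ?thesis using 7(4,5) eqs True pk unfolding B_def[symmetric] by simp
    qed
  next
    case (8 s')
    have "{c \<in> X. c < Suc n} = X" using X(2) by (auto simp: less_Suc_eq_le)
    then show ?case using 8(2) by simp
  qed simp_all
qed

section \<open>The alternating tree in memory\<close>

abbreviation itab :: "memory \<Rightarrow> name \<Rightarrow> nat \<Rightarrow> nat" where
  "itab s x \<equiv> \<lambda>c. ints s x [c]"

abbreviation rtab :: "memory \<Rightarrow> name \<Rightarrow> nat \<Rightarrow> real" where
  "rtab s x \<equiv> \<lambda>c. reals s x [c]"

abbreviation costs :: "memory \<Rightarrow> nat \<Rightarrow> nat \<Rightarrow> real" where
  "costs s \<equiv> \<lambda>r c. reals s ''z'' [r, c]"

definition tree_state :: "nat \<Rightarrow> nat \<Rightarrow> nat set \<Rightarrow> memory \<Rightarrow> bool" where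
  "tree_state n i X s \<longleftrightarrow>
     ints s ''n'' [] = n \<and> (\<forall>c\<in>{0..n}. ints s ''used'' [c] = (if c \<in> X then 1 else 0)) \<and>
     tree n (costs s) i (itab s ''p'') (rtab s ''u'') (rtab s ''v'') X
       (ints s ''j0'' []) (rtab s ''minv'') (itab s ''way'')"

definition grow_tree :: com where
  "grow_tree =
    (''used'' [V ''j0''] :=\<^sub>i N 1;;
     ''i0'' [] :=\<^sub>i I ''p'' [V ''j0''];;
     scan_columns;;
     update_potentials;;
     ''j0'' [] :=\<^sub>i V ''j1'')"

lemma mods_scan_columns [simp]:
  "imods scan_columns = {''j1'', ''j'', ''way''}"
  "rmods scan_columns = {''cur'', ''minv'', ''delta''}"
  by (auto simp: scan_columns_def)

lemma mods_update_potentials [simp]: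
  "imods update_potentials = {''j''}" "rmods update_potentials = {''u'', ''v'', ''minv''}"
  by (auto simp: update_potentials_def)

text \<open>The two passes compute what \<open>tree_step\<close> asks for: the scan yields
  \<open>minv1\<close>, \<open>way1\<close> and \<open>d\<close>, the shift yields the new
  potentials and \<open>minv2\<close>. The factor 22 is 12 + 10.\<close>

lemma grow_tree_spec:
  assumes ts: "tree_state n i X s" and pj: "ints s ''p'' [ints s ''j0'' []] \<noteq> 0"
  shows "runs grow_tree s (22 * (n + 1)) (tree_state n i (insert (ints s ''j0'' []) X))"
proof -
  define j where "j = ints s ''j0'' []"
  define p where "p = itab s ''p''"
  define F where "F = {1..n} - insert j X"
  let ?Y = "insert j X"
  have n: "ints s ''n'' [] = n"
    and used: "\<And>c. c \<in> {0..n} \<Longrightarrow> ints s ''used'' [c] = (if c \<in> X then 1 else 0)"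
    and tr: "tree n (costs s) i p (rtab s ''u'') (rtab s ''v'') X j (rtab s ''minv'') (itab s ''way'')"
    using ts by (auto simp: tree_state_def j_def p_def)
  have pj: "p j \<noteq> 0" using pj by (simp add: p_def j_def)
  have Fne: "F \<noteq> {}" using tree_free_column[OF tr pj] by (auto simp: F_def)
  have Yn: "?Y \<subseteq> {0..n}" using tr by (auto simp: tree_def)
  have pY: "p c \<noteq> 0" if "c \<in> ?Y" for c using that tr pj by (auto simp: tree_def)
  have mat: "matching (costs s) (rtab s ''u'') (rtab s ''v'') i {0..n} p" using tr by (simp add: tree_def)
  have inj: "inj_on p ?Y"
  proof (rule inj_onI)
    fix c d assume cd: "c \<in> ?Y" "d \<in> ?Y" "p c = p d"
    then have "c \<in> {0..n}" "d \<in> {0..n}" using Yn by blast+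
    then show "c = d" using mat pY[OF cd(1)] cd(3) unfolding matching_def by blast
  qed
  define s1 where "s1 = iupdate ''i0'' [] (p j) (iupdate ''used'' [j] 1 s)"
  have "runs grow_tree s (0 + 12 * (n + 1) + 10 * (n + 1) + 0) (tree_state n i ?Y)"
    unfolding grow_tree_def
  proof (rule runs_seq, rule runs_seq, rule runs_seq)
    show "runs (''used'' [V ''j0''] :=\<^sub>i N 1;; ''i0'' [] :=\<^sub>i I ''p'' [V ''j0'']) s 0 (\<lambda>s'. s' = s1)"
      using runs_straight[of "''used'' [V ''j0''] :=\<^sub>i N 1;; ''i0'' [] :=\<^sub>i I ''p'' [V ''j0'']"
          "\<lambda>s'. s' = s1" s]
      by (simp add: s1_def p_def j_def)
  next
    fix s' assume "s' = s1"
    moreover have "F = {c \<in> {1..n}. ints s1 ''used'' [c] = 0}"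
      using used by (auto simp: F_def s1_def split: if_splits)
    moreover have "ints s1 ''n'' [] = n" using n by (simp add: s1_def)
    ultimately have "runs scan_columns s' (12 * (n + 1)) (scanned F s1)"
      using scan_columns_spec by simp
    \<comment> \<open>The frame relative to \<open>s1\<close> is stored in the postcondition,
      because sequencing relates the result only to \<open>s\<close>.\<close>
    then show "runs scan_columns s' (12 * (n + 1))
        (\<lambda>s2. scanned F s1 s2 \<and> agree (imods scan_columns) (rmods scan_columns) s1 s2)"
      by (rule runs_mono) (use \<open>s' = s1\<close> in auto)
  next
    fix s2 assume "scanned F s1 s2 \<and> agree (imods scan_columns) (rmods scan_columns) s1 s2"
    then have sc: "scanned F s1 s2" and ag: "agree (imods scan_columns) (rmods scan_columns) s1 s2"
      by auto
    have eqs: "ints s2 ''n'' = ints s1 ''n''" "ints s2 ''used'' = ints s1 ''used''"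
      "ints s2 ''p'' = ints s1 ''p''" "reals s2 ''u'' = reals s1 ''u''" "reals s2 ''v'' = reals s1 ''v''"
      using agreeD[OF ag] by auto
    have p2: "itab s2 ''p'' = p" by (simp add: eqs s1_def p_def)
    have "runs update_potentials s2 (10 * (n + 1)) (\<lambda>s'.
      (\<forall>r. reals s' ''u'' [r] = (if r \<in> p ` ?Y
         then reals s2 ''u'' [r] + reals s2 ''delta'' [] else reals s2 ''u'' [r])) \<and>
      (\<forall>c. reals s' ''v'' [c] = (if c \<in> ?Y
         then reals s2 ''v'' [c] - reals s2 ''delta'' [] else reals s2 ''v'' [c])) \<and>
      (\<forall>c\<in>{0..n} - ?Y. reals s' ''minv'' [c] = reals s2 ''minv'' [c] - reals s2 ''delta'' []))"
      using update_potentials_spec[of s2 n ?Y] n used Yn inj unfolding p2 by (simp add: eqs s1_def)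
    then show "runs update_potentials s2 (10 * (n + 1)) (\<lambda>s3. tree_state n i ?Y (iupdate ''j0'' [] (ints s3 ''j1'' []) s3))"
    proof (rule runs_mono)
      fix s3 assume ag3: "agree (imods update_potentials) (rmods update_potentials) s2 s3"
        and up: "(\<forall>r. reals s3 ''u'' [r] = (if r \<in> p ` ?Y
         then reals s2 ''u'' [r] + reals s2 ''delta'' [] else reals s2 ''u'' [r])) \<and>
      (\<forall>c. reals s3 ''v'' [c] = (if c \<in> ?Y
         then reals s2 ''v'' [c] - reals s2 ''delta'' [] else reals s2 ''v'' [c])) \<and>
      (\<forall>c\<in>{0..n} - ?Y. reals s3 ''minv'' [c] = reals s2 ''minv'' [c] - reals s2 ''delta'' [])"
      have eqs3: "ints s3 ''n'' = ints s ''n''" "ints s3 ''used'' = ints s1 ''used''"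
        "ints s3 ''p'' = ints s ''p''" "ints s3 ''j1'' = ints s2 ''j1''" "ints s3 ''way'' = ints s2 ''way''"
        "reals s3 ''z'' = reals s ''z''"
        using agreeD[OF ag] agreeD[OF ag3] by (auto simp: s1_def fun_eq_iff)
      have red: "reduced s1 (ints s1 ''i0'' []) c = costs s (p j) c - rtab s ''u'' (p j) - rtab s ''v'' c" for c
        by (simp add: reduced_def s1_def)
      have "tree n (costs s) i p (rtab s3 ''u'') (rtab s3 ''v'') ?Y (ints s2 ''j1'' [])
        (rtab s3 ''minv'') (itab s2 ''way'')"
      proof (rule tree_step[OF tr pj F_def, where d = "reals s2 ''delta'' []" and ?minv1.0 = "rtab s2 ''minv''"])
        show "rtab s2 ''minv'' c = min (rtab s ''minv'' c) (costs s (p j) c - rtab s ''u'' (p j) - rtab s ''v'' c)"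
          if "c \<in> F" for c
          using sc that unfolding scanned_def red by (simp add: s1_def)
        show "itab s2 ''way'' c = (if c \<in> F \<and> costs s (p j) c - rtab s ''u'' (p j) - rtab s ''v'' c
             < rtab s ''minv'' c then j else itab s ''way'' c)" for c
          using sc unfolding scanned_def red by (simp add: s1_def j_def)
        show "ints s2 ''j1'' [] \<in> F" "reals s2 ''delta'' [] = rtab s2 ''minv'' (ints s2 ''j1'' [])"
          "\<And>c. c \<in> F \<Longrightarrow> reals s2 ''delta'' [] \<le> rtab s2 ''minv'' c"
          using sc Fne unfolding scanned_def by auto
        show "rtab s3 ''u'' r = (if r \<in> p ` ?Y then rtab s ''u'' r + reals s2 ''delta'' [] else rtab s ''u'' r)" for r
          using up eqs by (simp add: s1_def)
        show "rtab s3 ''v'' c = (if c \<in> ?Y then rtab s ''v'' c - reals s2 ''delta'' [] else rtab s ''v'' c)" for c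
          using up eqs by (simp add: s1_def)
        show "rtab s3 ''minv'' c = rtab s2 ''minv'' c - reals s2 ''delta'' []" if "c \<in> F" for c
          using up that by (simp add: F_def)
      qed
      then show "tree_state n i ?Y (iupdate ''j0'' [] (ints s3 ''j1'' []) s3)"
        using n used Yn unfolding tree_state_def p_def by (simp add: eqs3) (simp add: s1_def)
    qed simp
  next
    fix s3 assume "tree_state n i ?Y (iupdate ''j0'' [] (ints s3 ''j1'' []) s3)"
    then show "runs (''j0'' [] :=\<^sub>i V ''j1'') s3 0 (tree_state n i ?Y)"
      using runs_straight[of "''j0'' [] :=\<^sub>i V ''j1''" "tree_state n i ?Y" s3] by simp
  qed
  then show ?thesis unfolding j_def by simp
qed

text \<open>The rank of the current column serves as fuel. The loop body performs no arithmetic, so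
  a pass costs only its test.\<close>

lemma augment_spec:
  assumes "flipping n (costs s) (rtab s ''u'') (rtab s ''v'') i X (itab s ''way'') rk
      (itab s ''p'') (ints s ''j0'' [])" and "rk (ints s ''j0'' []) \<le> n"
  shows "runs augment s (n + 1)
    (\<lambda>s'. matching (costs s) (rtab s ''u'') (rtab s ''v'') i {1..n} (itab s' ''p''))"
proof -
  let ?f = "\<lambda>s'. flipping n (costs s) (rtab s ''u'') (rtab s ''v'') i X (itab s ''way'') rk
      (itab s' ''p'') (ints s' ''j0'' [])"
  let ?J = "\<lambda>k s'. ?f s' \<and> rk (ints s' ''j0'' []) \<le> k \<and> ints s' ''way'' = ints s ''way''"
  let ?b = "Not (V ''j0'' =\<^sub>i N 0)"
  have "runs augment s (n * (0 + bcost ?b) + bcost ?b) (\<lambda>s'. (\<exists>k. ?J k s') \<and> \<not> beval s' ?b)"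
    unfolding augment_def
  proof (rule runs_while)
    fix k t assume J: "?J k t" and "beval t ?b"
    define j where "j = ints t ''j0'' []"
    have j: "j \<noteq> 0" using \<open>beval t ?b\<close> by (simp add: j_def)
    have fl: "flipping n (costs s) (rtab s ''u'') (rtab s ''v'') i X (itab s ''way'') rk (itab t ''p'') j"
      using J by (simp add: j_def)
    note step = flipping_step[OF fl j]
    obtain k' where k': "k = Suc k'" "rk (itab s ''way'' j) \<le> k'"
      using step(2) J by (cases k) (auto simp: j_def)
    let ?c = "''j1'' [] :=\<^sub>i I ''way'' [V ''j0''];; ''p'' [V ''j0''] :=\<^sub>i I ''p'' [V ''j1''];;
       ''j0'' [] :=\<^sub>i V ''j1''"
    have tab: "itab (exec ?c t) ''p'' = (itab t ''p'')(j := itab t ''p'' (itab s ''way'' j))"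
      using J by (auto simp: j_def fun_eq_iff)
    have "?J k' (exec ?c t)" unfolding tab using J k' step(1) by (simp add: j_def fun_eq_iff)
    then have "runs ?c t (ccost ?c) (?J k')" by (intro runs_straight) simp_all
    then show "\<exists>k'. k = Suc k' \<and> runs ?c t 0 (?J k')" using k' by auto
  qed (use assms in simp)
  then show ?thesis
  proof (rule runs_mono)
    fix s' assume "(\<exists>k. ?J k s') \<and> \<not> beval s' ?b"
    \<comment> \<open>On exit the vacant column is the fictitious one, so every row up to
      \<open>i\<close> sits in a genuine column.\<close>
    then have "matching (costs s) (rtab s ''u'') (rtab s ''v'') i ({0..n} - {0}) (itab s' ''p'')"
      by (auto simp: flipping_def)
    moreover have "{0..n} - {0} = {1..n}" by auto
    ultimately show "matching (costs s) (rtab s ''u'') (rtab s ''v'') i {1..n} (itab s' ''p'')"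
      by simp
  qed simp
qed

lemma mods_augment [simp]: "imods augment = {''j1'', ''p'', ''j0''}" "rmods augment = {}"
  by (auto simp: augment_def)

lemma mods_grow_tree [simp]:
  "imods grow_tree = {''used'', ''i0'', ''j0'', ''j1'', ''j'', ''way''}"
  "rmods grow_tree = {''u'', ''v'', ''minv'', ''cur'', ''delta''}"
  by (auto simp: grow_tree_def)

section \<open>Inserting one row\<close>

definition stage :: "nat \<Rightarrow> nat \<Rightarrow> memory \<Rightarrow> bool" where
  "stage n i s \<longleftrightarrow> ints s ''n'' [] = n \<and> feasible n (costs s) (rtab s ''u'') (rtab s ''v'') \<and>
     matching (costs s) (rtab s ''u'') (rtab s ''v'') i {1..n} (itab s ''p'')"

definition start_row :: com where
  "start_row =
     (''p'' [N 0] :=\<^sub>i V ''i'';;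
      ''j0'' [] :=\<^sub>i N 0;;
      ''used'' [N 0] :=\<^sub>i N 0;;
      FOR ''j'' FROM N 1 TO V ''n'' DO (
        ''used'' [V ''j''] :=\<^sub>i N 0;;
        ''minv'' [V ''j''] :=\<^sub>r R ''z'' [V ''i'', V ''j''] \<ominus>\<^sub>r R ''u'' [V ''i''] \<ominus>\<^sub>r R ''v'' [V ''j''];;
        ''way'' [V ''j''] :=\<^sub>i N 0))"

lemma start_row_spec:
  assumes st: "stage n i s" and i: "ints s ''i'' [] = Suc i" "Suc i \<le> n"
  shows "runs start_row s (5 * (n + 1)) (tree_state n (Suc i) {})"
proof -
  let ?a = "''p'' [N 0] :=\<^sub>i V ''i'';; ''j0'' [] :=\<^sub>i N 0;; ''used'' [N 0] :=\<^sub>i N 0"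
  define s1 where "s1 = exec ?a s"
  \<comment> \<open>\<open>used\<close> is covered from index 0 because the root is cleared before
    the loop, whereas \<open>minv\<close> and \<open>way\<close> concern genuine columns
    only.\<close>
  let ?J = "\<lambda>k t. (\<forall>c\<in>{0..<k}. ints t ''used'' [c] = 0) \<and> (\<forall>c\<in>{1..<k}.
    reals t ''minv'' [c] = costs s (Suc i) c - rtab s ''u'' (Suc i) - rtab s ''v'' c \<and> ints t ''way'' [c] = 0)"
  have n: "ints s ''n'' [] = n" using st by (simp add: stage_def)
  have "runs start_row s (0 + 5 * (n + 1)) (tree_state n (Suc i) {})"
    unfolding start_row_def
  proof (rule runs_seq[where Q = "\<lambda>t. t = s1"])
    show "runs ?a s 0 (\<lambda>t. t = s1)" using runs_straight[of ?a "\<lambda>t. t = s1" s] by (simp add: s1_def)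
  next
    fix t assume "t = s1"
    show "runs (FOR ''j'' FROM N 1 TO V ''n'' DO (
        ''used'' [V ''j''] :=\<^sub>i N 0;;
        ''minv'' [V ''j''] :=\<^sub>r R ''z'' [V ''i'', V ''j''] \<ominus>\<^sub>r R ''u'' [V ''i''] \<ominus>\<^sub>r R ''v'' [V ''j''];;
        ''way'' [V ''j''] :=\<^sub>i N 0)) t (5 * (n + 1)) (tree_state n (Suc i) {})"
      unfolding \<open>t = s1\<close>
    proof (rule runs_for_straight[where J = ?J and lo = 1 and hi = n], goal_cases)
      case (5 s')
      have "ints s' ''n'' = ints s1 ''n''" by (rule agreeD(1)[OF 5]) simp
      then show ?case using n by (simp add: s1_def)
    next
      case 6
      show ?case by (simp add: s1_def)
    next
      case (7 k s')
      have eqs: "ints s' ''i'' = ints s ''i''" "reals s' ''z'' = reals s ''z''"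
        "reals s' ''u'' = reals s ''u''" "reals s' ''v'' = reals s ''v''"
        using agreeD[OF 7(3)] by (auto simp: s1_def fun_eq_iff)
      have "{1..<Suc k} = insert k {1..<k}" "{0..<Suc k} = insert k {0..<k}" using 7(1) by auto
      then show ?case using 7(4,5) i(1) by (simp add: eqs)
    next
      case (8 s')
      have eqs: "ints s' ''n'' = ints s ''n''" "ints s' ''p'' = ints s1 ''p''" "ints s' ''j0'' = ints s1 ''j0''"
        "reals s' ''z'' = reals s ''z''" "reals s' ''u'' = reals s ''u''" "reals s' ''v'' = reals s ''v''"
        using agreeD[OF 8(1)] by (auto simp: s1_def fun_eq_iff)
      have J: "\<And>c. c \<in> {1..n} \<Longrightarrow>
        reals s' ''minv'' [c] = costs s (Suc i) c - rtab s ''u'' (Suc i) - rtab s ''v'' c \<and> ints s' ''way'' [c] = 0"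
        using 8(2) by auto
      have "tree n (costs s) (Suc i) (itab s1 ''p'') (rtab s ''u'') (rtab s ''v'') {} 0
        (rtab s' ''minv'') (itab s' ''way'')"
        using st i J by (intro tree_init[where p = "itab s ''p''"]) (auto simp: stage_def s1_def)
      moreover have "\<forall>c\<in>{0..n}. ints s' ''used'' [c] = 0" using 8(2) by auto
      ultimately show ?case using n by (simp add: tree_state_def eqs s1_def)
    qed simp_all
  qed
  then show ?thesis by simp
qed


lemma mods_start_row [simp]:
  "imods start_row = {''p'', ''j0'', ''used'', ''j'', ''way''}" "rmods start_row = {''minv''}"
  by (auto simp: start_row_def)

lemma insert_row_eq:
  "insert_row = (start_row;; WHILE Not (I ''p'' [V ''j0''] =\<^sub>i N 0) DO grow_tree;; augment)"
  by (simp add: insert_row_def start_row_def grow_tree_def)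

text \<open>Each growth step adds a column of \<open>{0..n}\<close>, so fuel plus tree size stays at
  \<open>n + 1\<close>. The search stops at a column without a row, which is what
  \<open>flipping_init\<close> requires.\<close>

lemma insert_row_spec:
  assumes st: "stage n i s" and i: "ints s ''i'' [] = Suc i" "Suc i \<le> n"
  shows "runs insert_row s (40 * (n + 1)\<^sup>2) (stage n (Suc i))"
proof -
  let ?b = "Not (I ''p'' [V ''j0''] =\<^sub>i N 0)"
  let ?J = "\<lambda>k t. \<exists>X. tree_state n (Suc i) X t \<and> k + card X = n + 1"
  have "runs insert_row s (5 * (n + 1) + ((n + 1) * (22 * (n + 1) + bcost ?b) + bcost ?b) + (n + 1))
    (stage n (Suc i))"
    unfolding insert_row_eq
  proof (rule runs_seq, rule runs_seq)
    show "runs start_row s (5 * (n + 1)) (tree_state n (Suc i) {})"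
      using start_row_spec[OF st i] .
  next
    fix t assume t: "tree_state n (Suc i) {} t"
    show "runs (WHILE ?b DO grow_tree) t ((n + 1) * (22 * (n + 1) + bcost ?b) + bcost ?b)
      (\<lambda>t'. (\<exists>k. ?J k t') \<and> \<not> beval t' ?b)"
    proof (rule runs_while)
      fix k t assume "?J k t" and b: "beval t ?b"
      then obtain X where X: "tree_state n (Suc i) X t" "k + card X = n + 1" by blast
      let ?Y = "insert (ints t ''j0'' []) X"
      have new: "ints t ''j0'' [] \<notin> X" and sub: "?Y \<subseteq> {0..n}"
        using X(1) by (auto simp: tree_state_def tree_def)
      have "finite ?Y" by (rule finite_subset[OF sub]) simp
      then have "card ?Y = Suc (card X)" using new by simp
      moreover have "card ?Y \<le> n + 1" using card_mono[OF _ sub] by simp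
      ultimately obtain k' where k': "k = Suc k'" "k' + card ?Y = n + 1" using X(2) by (cases k) auto
      have "runs grow_tree t (22 * (n + 1)) (tree_state n (Suc i) ?Y)"
        using grow_tree_spec[OF X(1)] b by simp
      then have "runs grow_tree t (22 * (n + 1)) (?J k')"
        by (rule runs_mono) (use k' in blast)+
      then show "\<exists>k'. k = Suc k' \<and> runs grow_tree t (22 * (n + 1)) (?J k')" using k'(1) by blast
    next
      show "?J (n + 1) t" using t by (intro exI[of _ "{}"]) simp
    qed
  next
    fix t assume "(\<exists>k. ?J k t) \<and> \<not> beval t ?b"
    then obtain X where ts: "tree_state n (Suc i) X t" and "ints t ''p'' [ints t ''j0'' []] = 0"
      by auto
    then obtain rk where "flipping n (costs t) (rtab t ''u'') (rtab t ''v'') (Suc i)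
      (insert (ints t ''j0'' []) X) (itab t ''way'') rk (itab t ''p'') (ints t ''j0'' [])"
      "rk (ints t ''j0'' []) \<le> n"
      by (auto simp: tree_state_def elim: flipping_init)
    from augment_spec[OF this] show "runs augment t (n + 1) (stage n (Suc i))"
    proof (rule runs_mono)
      fix t' assume ag: "agree (imods augment) (rmods augment) t t'"
        and "matching (costs t) (rtab t ''u'') (rtab t ''v'') (Suc i) {1..n} (itab t' ''p'')"
      moreover have "ints t' ''n'' = ints t ''n''" "reals t' = reals t"
        using agreeD[OF ag] by (auto simp: fun_eq_iff)
      ultimately show "stage n (Suc i) t'" using ts by (simp add: stage_def tree_state_def tree_def)
    qed simp
  qed
  then show ?thesis by (rule runs_mono) (simp_all add: power2_eq_square algebra_simps)
qed

lemma mods_insert_row [simp]: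
  "imods insert_row = {''p'', ''j0'', ''used'', ''j'', ''way'', ''i0'', ''j1''}"
  "rmods insert_row = {''minv'', ''u'', ''v'', ''cur'', ''delta''}"
  by (auto simp: insert_row_eq)

text \<open>Feasibility of the zero potentials comes from the nonnegative costs and starts the
  induction on rows; the permutation returned is the inverse of the final matching.\<close>

lemma hungarian_spec:
  assumes n: "ints s ''n'' [] = n"
    and nonneg: "\<And>r c. r \<in> {1..n} \<Longrightarrow> c \<in> {1..n} \<Longrightarrow> 0 \<le> costs s r c"
  shows "runs hungarian s (60 * (n + 1) ^ 3) (\<lambda>t. \<exists>\<sigma>. \<sigma> permutes {1..n} \<and>
    (\<forall>r\<in>{1..n}. ints t ''sigma'' [r] = \<sigma> r) \<and>
    (\<forall>\<tau>. \<tau> permutes {1..n} \<longrightarrow> (\<Sum>r = 1..n. costs s r (\<sigma> r)) \<le> (\<Sum>r = 1..n. costs s r (\<tau> r))))"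
    (is "runs _ _ _ ?Q")
proof -
  have "runs hungarian s (5 * (n + 1) + (n * (40 * (n + 1)\<^sup>2 + 2) + 1) + (2 * n + 1)) ?Q"
    unfolding hungarian_def
  proof (rule runs_seq, rule runs_seq)
    let ?J = "\<lambda>k t. \<forall>c\<in>{0..<k}. rtab t ''u'' c = 0 \<and> rtab t ''v'' c = 0 \<and> itab t ''p'' c = 0"
    show "runs (FOR ''j'' FROM N 0 TO V ''n'' DO (
        ''u'' [V ''j''] :=\<^sub>r C 0;; ''v'' [V ''j''] :=\<^sub>r C 0;; ''p'' [V ''j''] :=\<^sub>i N 0)) s (5 * (n + 1))
      (\<lambda>t. stage n 0 t \<and> reals t ''z'' = reals s ''z'')"
    proof (rule runs_for_straight[where J = ?J and lo = 0 and hi = n], goal_cases)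
      case (5 t)
      have "ints t ''n'' = ints s ''n''" by (rule agreeD(1)[OF 5]) simp
      then show ?case using n by simp
    next
      case (7 k t)
      have "{0..<Suc k} = insert k {0..<k}" by auto
      then show ?case using 7(4,5) by simp
    next
      case (8 t)
      have eqs: "ints t ''n'' = ints s ''n''" "reals t ''z'' = reals s ''z''"
        using agreeD[OF 8(1)] by auto
      have "\<And>c. c \<in> {1..n} \<Longrightarrow> rtab t ''u'' c = 0 \<and> rtab t ''v'' c = 0 \<and> itab t ''p'' c = 0"
        using 8(2) by auto
      then show ?case using n nonneg by (simp add: stage_def feasible_def matching_def eqs)
    qed simp_all
  next
    fix t :: memory assume t: "stage n 0 t \<and> reals t ''z'' = reals s ''z''"
    show "runs (FOR ''i'' FROM N 1 TO V ''n'' DO insert_row) t (n * (40 * (n + 1)\<^sup>2 + 2) + 1)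
      (\<lambda>t. stage n n t \<and> reals t ''z'' = reals s ''z'')"
    proof (rule runs_mono)
      show "runs (FOR ''i'' FROM N 1 TO V ''n'' DO insert_row) t
        (icost (N 1) + ((n + 1 - 1) * (40 * (n + 1)\<^sup>2 + icost (V ''n'') + 2) + icost (V ''n'') + 1))
        (\<lambda>t. stage n n t \<and> reals t ''z'' = reals s ''z'')"
      \<comment> \<open>With the counter at \<open>k\<close>, the rows inserted so far are those
        below \<open>k\<close>.\<close>
      proof (rule runs_for[where J = "\<lambda>k. stage n (k - 1)"], goal_cases)
        case (4 t')
        have "ints t' ''n'' = ints t ''n''" by (rule agreeD(1)[OF 4]) simp
        then show ?case using t by (simp add: stage_def)
      next
        case 5
        then show ?case using conjunct1[OF t] by (simp add: stage_def)
      next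
        case (6 k t')
        then have "runs insert_row t' (40 * (n + 1)\<^sup>2) (stage n (Suc (k - 1)))"
          by (intro insert_row_spec) auto
        then show ?case by (rule runs_mono) (use 6(1) in \<open>simp_all add: stage_def\<close>)
      next
        case (7 t')
        have "reals t' ''z'' = reals t ''z''" using agreeD[OF 7(1)] by simp
        then show ?case using 7(2) t by simp
      qed simp_all
    qed simp_all
  next
    fix t :: memory assume t: "stage n n t \<and> reals t ''z'' = reals s ''z''"
    define p where "p = itab t ''p''"
    have feas: "feasible n (costs s) (rtab t ''u'') (rtab t ''v'')"
      and mat: "matching (costs s) (rtab t ''u'') (rtab t ''v'') n {1..n} p"
      using t by (auto simp: stage_def p_def)
    note bij = perfect_matching_bij[OF mat]
    let ?J = "\<lambda>k t'. \<forall>c\<in>{1..<k}. itab t' ''sigma'' (p c) = c"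
    show "runs (FOR ''j'' FROM N 1 TO V ''n'' DO ''sigma'' [I ''p'' [V ''j'']] :=\<^sub>i V ''j'') t (2 * n + 1) ?Q"
    proof (rule runs_for_straight[where J = ?J and lo = 1 and hi = n], goal_cases)
      case (5 t')
      have "ints t' ''n'' = ints t ''n''" by (rule agreeD(1)[OF 5]) simp
      then show ?case using t by (simp add: stage_def)
    next
      case (7 k t')
      have "ints t' ''p'' = ints t ''p''" by (rule agreeD(1)[OF 7(3)]) simp
      \<comment> \<open>Distinct columns carry distinct rows, so writing \<open>sigma\<close> at
        \<open>p k\<close> spares the earlier entries.\<close>
      moreover have "p c \<noteq> p k" if "c \<in> {1..<k}" for c
        using inj_onD[OF bij_betw_imp_inj_on[OF bij], of c k] that 7(2) by auto
      moreover have "{1..<Suc k} = insert k {1..<k}" using 7(1) by auto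
      ultimately show ?case using 7(4,5) by (simp add: p_def)
    next
      case (8 t')
      then have J: "\<And>c. c \<in> {1..n} \<Longrightarrow> itab t' ''sigma'' (p c) = c" by auto
      \<comment> \<open>\<open>permutes\<close> demands the identity off the range, where the array
        may hold anything.\<close>
      define \<sigma> where "\<sigma> = (\<lambda>r. if r \<in> {1..n} then itab t' ''sigma'' r else r)"
      have im: "{1..n} = p ` {1..n}" using bij by (simp add: bij_betw_def)
      have pn: "p c \<in> {1..n}" if "c \<in> {1..n}" for c using im that by blast
      have \<sigma>p: "\<sigma> (p c) = c" if "c \<in> {1..n}" for c using J pn that by (simp add: \<sigma>_def)
      have "bij_betw \<sigma> {1..n} {1..n}"
      proof (rule bij_betw_byWitness[where f' = p])
        show "\<forall>r\<in>{1..n}. p (\<sigma> r) = r"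
        proof
          fix r assume "r \<in> {1..n}"
          then obtain c where "c \<in> {1..n}" "r = p c" using im by blast
          then show "p (\<sigma> r) = r" using \<sigma>p by metis
        qed
        show "\<forall>c\<in>{1..n}. \<sigma> (p c) = c" using \<sigma>p by blast
        show "p ` {1..n} \<subseteq> {1..n}" using pn by blast
        show "\<sigma> ` {1..n} \<subseteq> {1..n}"
        proof
          fix x assume "x \<in> \<sigma> ` {1..n}"
          then obtain r where "r \<in> {1..n}" "x = \<sigma> r" by blast
          moreover from this(1) obtain c where "c \<in> {1..n}" "r = p c" using im by blast
          ultimately show "x \<in> {1..n}" using \<sigma>p by metis
        qed
      qed
      then have "\<sigma> permutes {1..n}" by (rule bij_imp_permutes) (auto simp: \<sigma>_def)
      moreover have "\<forall>\<tau>. \<tau> permutes {1..n} \<longrightarrow>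
        (\<Sum>r = 1..n. costs s r (\<sigma> r)) \<le> (\<Sum>r = 1..n. costs s r (\<tau> r))"
        using perfect_matching_optimal[OF feas mat \<sigma>p] by blast
      ultimately show ?case by (intro exI[of _ \<sigma>]) (simp add: \<sigma>_def)
    qed simp_all
  qed
  then show ?thesis
    by (rule runs_mono) (simp_all add: power2_eq_square power3_eq_cube algebra_simps)
qed


section \<open>Reduction of the pairing problem\<close>

text \<open>The witness \<open>x\<close> is the computed maximum: as an upper bound it makes the
  costs nonnegative, and as a constant it shifts the cost of all assignments equally.\<close>

lemma build_costs_spec:
  assumes M: "ints s ''M'' [] = M"
  shows "runs build_costs s (20 * (2 * M + 1)\<^sup>2) (\<lambda>t. ints t ''n'' [] = 2 * M \<and>
    (\<exists>x. \<forall>r\<in>{1..2 * M}. \<forall>m\<in>{1..M}. reals s ''g'' [r, m] \<le> x \<and>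
      costs t r m = x - reals s ''g'' [r, m] \<and> costs t r (M + m) = x - reals s ''g'' [r, m]))"
    (is "runs _ _ _ ?Q")
proof -
  let ?a = "''n'' [] :=\<^sub>i V ''M'' \<oplus>\<^sub>i V ''M'';; ''gmax'' [] :=\<^sub>r R ''g'' [N 1, N 1]"
  let ?P = "\<lambda>t. ints t ''n'' [] = 2 * M \<and> ints t ''M'' [] = M \<and> reals t ''g'' = reals s ''g''"
  let ?G = "\<lambda>t. \<forall>r\<in>{1..2 * M}. \<forall>m\<in>{1..M}. reals s ''g'' [r, m] \<le> reals t ''gmax'' []"
  have "runs build_costs s (1 + (2 * M * (5 * M + 3) + 1) + (2 * M * (7 * M + 3) + 1)) ?Q"
    unfolding build_costs_def
  proof (rule runs_seq, rule runs_seq)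
    have "?P (exec ?a s)" using M by (simp add: fun_eq_iff)
    from runs_straight[of ?a ?P s, OF _ this] show "runs ?a s 1 ?P" by simp
  next
    fix t :: memory assume t: "?P t"
    let ?c = "IF R ''gmax'' [] <\<^sub>r R ''g'' [V ''i'', V ''m'']
        THEN ''gmax'' [] :=\<^sub>r R ''g'' [V ''i'', V ''m''] ELSE SKIP"
    let ?J = "\<lambda>k t. \<forall>r\<in>{1..<k}. \<forall>m\<in>{1..M}. reals s ''g'' [r, m] \<le> reals t ''gmax'' []"
    have "runs (FOR ''i'' FROM N 1 TO V ''n'' DO FOR ''m'' FROM N 1 TO V ''M'' DO ?c) t
        (icost (N 1) + ((2 * M + 1 - 1) * ((5 * M + 1) + icost (V ''n'') + 2) + icost (V ''n'') + 1))
        (\<lambda>t. ?P t \<and> ?G t)"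
    proof (rule runs_for[where J = ?J], goal_cases)
      case (4 t')
      have "ints t' ''n'' = ints t ''n''" by (rule agreeD(1)[OF 4]) simp
      then show ?case using t by simp
    next
      case (6 k t')
      let ?K = "\<lambda>l u. ?J k u \<and> (\<forall>m\<in>{1..<l}. reals s ''g'' [k, m] \<le> reals u ''gmax'' [])"
      show ?case
      proof (rule runs_for_straight[where J = ?K and lo = 1 and hi = M], goal_cases)
        case (5 u)
        have "ints u ''M'' = ints t ''M''"
          using agreeD[OF 5] agreeD[OF 6(3)] by simp
        then show ?case using t by simp
      next
        case 6
        then show ?case using \<open>?J k t'\<close> by simp
      next
        case (7 l u)
        have eqs: "reals u ''g'' = reals s ''g''" "ints u ''i'' [] = k"
          using agreeD[OF 7(3)] agreeD[OF 6(3)] 6(4) t by simp_all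
        \<comment> \<open>Naming the new maximum keeps its conditional from being split again for
          every earlier entry.\<close>
        define y where "y = reals (exec ?c u) ''gmax'' []"
        have "{1..<Suc l} = insert l {1..<l}" using 7(1) by auto
        moreover have "a \<le> y" if "a \<le> reals u ''gmax'' []" for a
          using that by (auto simp: y_def)
        moreover have "reals s ''g'' [k, l] \<le> y" using eqs 7(4) by (auto simp: y_def)
        ultimately show ?case unfolding reals_iupdate y_def[symmetric] using 7(5) by simp
      next
        case (8 u)
        have "{1..<Suc k} = insert k {1..<k}" using 6(1) by auto
        then show ?case using 8(2) by auto
      qed simp_all
    next
      case (7 t')
      have "ints t' ''n'' = ints t ''n''" "ints t' ''M'' = ints t ''M''" "reals t' ''g'' = reals t ''g''"
        using agreeD[OF 7(1)] by simp_all
      then show ?case using t 7(2) by auto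
    qed simp_all
    then show "runs (FOR ''i'' FROM N 1 TO V ''n'' DO FOR ''m'' FROM N 1 TO V ''M'' DO ?c) t
        (2 * M * (5 * M + 3) + 1) (\<lambda>t. ?P t \<and> ?G t)"
      by (rule runs_mono) (simp_all add: algebra_simps)
  next
    fix t :: memory assume t: "?P t \<and> ?G t"
    let ?c = "''z'' [V ''i'', V ''m''] :=\<^sub>r R ''gmax'' [] \<ominus>\<^sub>r R ''g'' [V ''i'', V ''m''];;
        ''z'' [V ''i'', V ''M'' \<oplus>\<^sub>i V ''m''] :=\<^sub>r R ''gmax'' [] \<ominus>\<^sub>r R ''g'' [V ''i'', V ''m'']"
    define x where "x = reals t ''gmax'' []"
    let ?ok = "\<lambda>u r m. costs u r m = x - reals s ''g'' [r, m] \<and> costs u r (M + m) = x - reals s ''g'' [r, m]"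
    let ?J = "\<lambda>k u. \<forall>r\<in>{1..<k}. \<forall>m\<in>{1..M}. ?ok u r m"
    have "runs (FOR ''i'' FROM N 1 TO V ''n'' DO FOR ''m'' FROM N 1 TO V ''M'' DO (?c)) t
        (icost (N 1) + ((2 * M + 1 - 1) * ((7 * M + 1) + icost (V ''n'') + 2) + icost (V ''n'') + 1)) ?Q"
    proof (rule runs_for[where J = ?J], goal_cases)
      case (4 t')
      have "ints t' ''n'' = ints t ''n''" by (rule agreeD(1)[OF 4]) simp
      then show ?case using t by simp
    next
      case (6 k t')
      let ?K = "\<lambda>l u. ?J k u \<and> (\<forall>m\<in>{1..<l}. ?ok u k m)"
      show ?case
      proof (rule runs_for_straight[where J = ?K and lo = 1 and hi = M], goal_cases)
        case (5 u)
        have "ints u ''M'' = ints t ''M''"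
          using agreeD[OF 5] agreeD[OF 6(3)] by simp
        then show ?case using t by simp
      next
        case 6
        then show ?case using \<open>?J k t'\<close> by simp
      next
        case (7 l u)
        have eqs: "reals u ''g'' = reals s ''g''" "ints u ''i'' [] = k" "ints u ''M'' [] = M"
          "reals u ''gmax'' [] = x"
          using agreeD[OF 7(3)] agreeD[OF 6(3)] 6(4) t by (simp_all add: x_def)
        have "{1..<Suc l} = insert l {1..<l}" using 7(1) by auto
        then show ?case using 7(2,4,5) by (auto simp: eqs)
      next
        case (8 u)
        have "{1..<Suc k} = insert k {1..<k}" using 6(1) by auto
        then show ?case using 8(2) by auto
      qed simp_all
    next
      case (7 t')
      have "ints t' ''n'' = ints t ''n''" using agreeD[OF 7(1)] by simp
      moreover have "\<forall>r\<in>{1..2 * M}. \<forall>m\<in>{1..M}. reals s ''g'' [r, m] \<le> x \<and> ?ok t' r m"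
        using t 7(2) by (auto simp: x_def)
      ultimately show ?case using t by auto
    qed simp_all
    then show "runs (FOR ''i'' FROM N 1 TO V ''n'' DO FOR ''m'' FROM N 1 TO V ''M'' DO (?c)) t
        (2 * M * (7 * M + 3) + 1) ?Q"
      by (rule runs_mono) (simp_all add: algebra_simps)
  qed
  then show ?thesis by (rule runs_mono) (simp_all add: power2_eq_square algebra_simps)
qed

section \<open>Columns of the cost matrix and places in the pairs\<close>

text \<open>Column \<open>column M k\<close> of the cost matrix stands for position \<open>k\<close> of the permutation \<open>\<ell>\<close>.\<close>

definition position :: "nat \<Rightarrow> nat \<Rightarrow> nat" where
  "position M c = (if c \<le> M then 2 * c - 1 else 2 * (c - M))"

definition column :: "nat \<Rightarrow> nat \<Rightarrow> nat" where
  "column M k = (if k \<in> {1..2 * M} then if even k then M + k div 2 else (k + 1) div 2 else k)"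

lemma position_column: "k \<in> {1..2 * M} \<Longrightarrow> position M (column M k) = k"
  by (auto simp: position_def column_def elim!: oddE evenE)

lemma column_position: "c \<in> {1..2 * M} \<Longrightarrow> column M (position M c) = c"
  by (auto simp: position_def column_def)

lemma position_in: "c \<in> {1..2 * M} \<Longrightarrow> position M c \<in> {1..2 * M}"
  by (auto simp: position_def)

lemma column_in: "k \<in> {1..2 * M} \<Longrightarrow> column M k \<in> {1..2 * M}"
  by (auto simp: column_def elim!: oddE evenE)

text \<open>\<open>position M\<close> inverts \<open>column M\<close> on the range; the fallback to
  the identity beyond it is what \<open>permutes\<close> demands.\<close>

lemma column_permutes: "column M permutes {1..2 * M}"
proof (rule bij_imp_permutes)
  show "bij_betw (column M) {1..2 * M} {1..2 * M}"
    using position_column column_position position_in column_in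
    by (intro bij_betw_byWitness[where f' = "position M"]) blast+
qed (auto simp: column_def)

text \<open>The array \<open>l\<close> receives the inverse of
  \<open>position M \<circ> \<sigma>\<close>. Both factors are injective on the range, so no cell is
  written twice.\<close>

lemma read_pairing_spec:
  assumes n: "ints s ''n'' [] = 2 * M" and M: "ints s ''M'' [] = M"
    and \<sigma>: "\<sigma> permutes {1..2 * M}" "\<And>r. r \<in> {1..2 * M} \<Longrightarrow> ints s ''sigma'' [r] = \<sigma> r"
  shows "runs read_pairing s (10 * (2 * M + 1))
    (\<lambda>t. \<forall>r\<in>{1..2 * M}. ints t ''l'' [position M (\<sigma> r)] = r)"
proof -
  let ?J = "\<lambda>k t. \<forall>r\<in>{1..<k}. ints t ''l'' [position M (\<sigma> r)] = r"
  show ?thesis unfolding read_pairing_def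
  proof (rule runs_for_straight[where J = ?J and lo = 1 and hi = "2 * M"], goal_cases)
    case (5 t)
    have "ints t ''n'' = ints s ''n''" by (rule agreeD(1)[OF 5]) simp
    then show ?case using n by simp
  next
    case (7 k t)
    have eqs: "ints t ''M'' [] = M" "ints t ''sigma'' [k] = \<sigma> k"
      using agreeD[OF 7(3)] M \<sigma>(2)[of k] 7(1,2) by simp_all
    have new: "position M (\<sigma> r) \<noteq> position M (\<sigma> k)" if r: "r \<in> {1..<k}" for r
    proof
      have "\<sigma> r \<in> {1..2 * M}" "\<sigma> k \<in> {1..2 * M}"
        using permutes_in_image[OF \<sigma>(1)] r 7(1,2) by auto
      moreover assume "position M (\<sigma> r) = position M (\<sigma> k)"
      ultimately have "\<sigma> r = \<sigma> k" using column_position by metis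
      then show False using injD[OF permutes_inj[OF \<sigma>(1)]] r by fastforce
    qed
    have "{1..<Suc k} = insert k {1..<k}" using 7(1) by auto
    \<comment> \<open>Both branches address the cell \<open>position M (\<sigma> k)\<close>:
      \<open>j + j - 1\<close> is the odd place of a column up to \<open>M\<close>, twice
      \<open>j - M\<close> the even place of a later one.\<close>
    moreover have "ints (iupdate ''i'' [] (Suc k) (exec (
         ''j'' [] :=\<^sub>i I ''sigma'' [V ''i''];;
         IF V ''j'' \<le>\<^sub>i V ''M''
         THEN ''l'' [V ''j'' \<oplus>\<^sub>i V ''j'' \<ominus>\<^sub>i N 1] :=\<^sub>i V ''i''
         ELSE ''l'' [(V ''j'' \<ominus>\<^sub>i V ''M'') \<oplus>\<^sub>i (V ''j'' \<ominus>\<^sub>i V ''M'')] :=\<^sub>i V ''i'') t)) ''l'' [x] =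
       (if x = position M (\<sigma> k) then k else ints t ''l'' [x])" for x
      by (simp add: eqs 7(4) position_def mult_2)
    ultimately show ?case using 7(5) new by simp
  next
    case (8 t)
    then show ?case by auto
  qed simp_all
qed

section \<open>Pairing values and assignment costs\<close>

lemma sum_split_parity:
  fixes f :: "nat \<Rightarrow> 'a :: comm_monoid_add"
  shows "(\<Sum>k = 1..2 * M. f k) = (\<Sum>m = 1..M. f (2 * m - 1) + f (2 * m))"
  by (induction M) (simp_all add: algebra_simps)

text \<open>Index \<open>r\<close> stands at place \<open>inv l r\<close>, so it is assigned the
  column of that place. When the sum runs over places instead of indices, the two copies of column
  \<open>m\<close> give back the two terms of pair \<open>m\<close>, and each of the
  \<open>2 * M\<close> entries contributes one \<open>x\<close>.\<close>

lemma pairing_value_eq_cost: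
  assumes \<pi>: "\<And>m. m \<in> {1..M} \<Longrightarrow> \<pi> m = (l (2 * m - 1), l (2 * m))" and l: "l permutes {1..2 * M}"
    and z: "\<And>r m. r \<in> {1..2 * M} \<Longrightarrow> m \<in> {1..M} \<Longrightarrow>
      z r m = x - g r m \<and> z r (M + m) = x - g r m"
  shows "pairing_value M g \<pi> = real (2 * M) * x - (\<Sum>r = 1..2 * M. z r ((column M \<circ> inv l) r))"
proof -
  have "(\<Sum>r = 1..2 * M. x - z r ((column M \<circ> inv l) r)) =
      (\<Sum>k = 1..2 * M. x - z (l k) ((column M \<circ> inv l) (l k)))"
    using sum.permute[OF l, of "\<lambda>r. x - z r ((column M \<circ> inv l) r)"] by (simp only: comp_def)
  also have "\<dots> = (\<Sum>k = 1..2 * M. x - z (l k) (column M k))"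
    using permutes_inverses(2)[OF l] by simp
  also have "\<dots> = (\<Sum>m = 1..M. g (l (2 * m - 1)) m + g (l (2 * m)) m)"
    unfolding sum_split_parity
  proof (rule sum.cong[OF refl])
    fix m assume m: "m \<in> {1..M}"
    then have "column M (2 * m - 1) = m" "column M (2 * m) = M + m"
      "2 * m - 1 \<in> {1..2 * M}" "2 * m \<in> {1..2 * M}"
      by (auto simp: column_def)
    moreover from this have "l (2 * m - 1) \<in> {1..2 * M}" "l (2 * m) \<in> {1..2 * M}"
      using permutes_in_image[OF l] by blast+
    ultimately show "(x - z (l (2 * m - 1)) (column M (2 * m - 1))) + (x - z (l (2 * m)) (column M (2 * m))) =
        g (l (2 * m - 1)) m + g (l (2 * m)) m"
      using z m by simp
  qed
  also have "\<dots> = pairing_value M g \<pi>" unfolding pairing_value_def using \<pi> by simp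
  finally show ?thesis by (simp add: sum_subtractf)
qed

theorem lemma2:
  shows "\<exists>P :: nat poly. \<forall>(M :: nat) (g :: nat \<Rightarrow> nat \<Rightarrow> real) s.
           M \<ge> 1 \<longrightarrow> holds_problem M g s \<longrightarrow>
           (\<exists>t s'. run pairing_program s t s' \<and>
                   is_arg_max (pairing_value M g) (\<lambda>\<pi>. \<pi> \<in> pairings M) (stored_pairing s') \<and>
                   t \<le> poly P M)"
proof (rule exI, intro allI impI)
  fix M g s
  assume hp: "holds_problem M g s"
  let ?I = "{1..2 * M}"
  let ?Q = "\<lambda>t. is_arg_max (pairing_value M g) (\<lambda>\<pi>. \<pi> \<in> pairings M) (stored_pairing t)"
  let ?z = "\<lambda>x t. \<forall>r\<in>?I. \<forall>m\<in>{1..M}. g r m \<le> x \<and>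
    costs t r m = x - g r m \<and> costs t r (M + m) = x - g r m"
  have M: "ints s ''M'' [] = M" and g: "\<And>r m. r \<in> ?I \<Longrightarrow> m \<in> {1..M} \<Longrightarrow> reals s ''g'' [r, m] = g r m"
    using hp by (auto simp: holds_problem_def)
  have "runs pairing_program s
      (20 * (2 * M + 1)\<^sup>2 + 60 * (2 * M + 1) ^ 3 + 10 * (2 * M + 1)) ?Q"
    unfolding pairing_program_def
  proof (rule runs_seq, rule runs_seq)
    show "runs build_costs s (20 * (2 * M + 1)\<^sup>2)
        (\<lambda>t. ints t ''n'' [] = 2 * M \<and> ints t ''M'' [] = M \<and> (\<exists>x. ?z x t))"
      using build_costs_spec[OF M]
    proof (rule runs_mono)
      fix t :: memory assume ag: "agree (imods build_costs) (rmods build_costs) s t"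
      have "ints t ''M'' = ints s ''M''" using agreeD[OF ag] by (simp add: build_costs_def)
      moreover assume "ints t ''n'' [] = 2 * M \<and> (\<exists>x. \<forall>r\<in>?I. \<forall>m\<in>{1..M}. reals s ''g'' [r, m] \<le> x \<and>
        costs t r m = x - reals s ''g'' [r, m] \<and> costs t r (M + m) = x - reals s ''g'' [r, m])"
      ultimately show "ints t ''n'' [] = 2 * M \<and> ints t ''M'' [] = M \<and> (\<exists>x. ?z x t)"
        using M g by simp
    qed simp
  next
    fix t :: memory assume t: "ints t ''n'' [] = 2 * M \<and> ints t ''M'' [] = M \<and> (\<exists>x. ?z x t)"
    then obtain x where z: "?z x t" by blast
    have "0 \<le> costs t r c" if "r \<in> ?I" "c \<in> ?I" for r c
    proof (cases "c \<le> M")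
      case True
      then show ?thesis using z that by simp
    next
      case False
      then have "c - M \<in> {1..M}" using that(2) by auto
      then have "costs t r (M + (c - M)) = x - g r (c - M)" "g r (c - M) \<le> x"
        using z that(1) by blast+
      then show ?thesis using False by simp
    qed
    moreover have "ints t ''n'' [] = 2 * M" using t by blast
    ultimately have "runs hungarian t (60 * (2 * M + 1) ^ 3) (\<lambda>t'. \<exists>\<sigma>. \<sigma> permutes ?I \<and>
      (\<forall>r\<in>?I. ints t' ''sigma'' [r] = \<sigma> r) \<and>
      (\<forall>\<tau>. \<tau> permutes ?I \<longrightarrow> (\<Sum>r\<in>?I. costs t r (\<sigma> r)) \<le> (\<Sum>r\<in>?I. costs t r (\<tau> r))))"
      by (intro hungarian_spec)
    \<comment> \<open>Optimality is restated for the costs in the final memory, which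
      \<open>hungarian\<close> never writes, so that the next stage refers to a single
      memory.\<close>
    then show "runs hungarian t (60 * (2 * M + 1) ^ 3) (\<lambda>t'. ints t' ''n'' [] = 2 * M \<and> ints t' ''M'' [] = M \<and>
      (\<exists>x. ?z x t') \<and> (\<exists>\<sigma>. \<sigma> permutes ?I \<and> (\<forall>r\<in>?I. ints t' ''sigma'' [r] = \<sigma> r) \<and>
      (\<forall>\<tau>. \<tau> permutes ?I \<longrightarrow> (\<Sum>r\<in>?I. costs t' r (\<sigma> r)) \<le> (\<Sum>r\<in>?I. costs t' r (\<tau> r)))))"
    proof (rule runs_mono)
      fix t' :: memory assume ag: "agree (imods hungarian) (rmods hungarian) t t'"
      assume "\<exists>\<sigma>. \<sigma> permutes ?I \<and> (\<forall>r\<in>?I. ints t' ''sigma'' [r] = \<sigma> r) \<and>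
        (\<forall>\<tau>. \<tau> permutes ?I \<longrightarrow> (\<Sum>r\<in>?I. costs t r (\<sigma> r)) \<le> (\<Sum>r\<in>?I. costs t r (\<tau> r)))"
      moreover have "ints t' ''n'' = ints t ''n''" "ints t' ''M'' = ints t ''M''" "reals t' ''z'' = reals t ''z''"
        using agreeD[OF ag] by (simp_all add: hungarian_def)
      ultimately show "ints t' ''n'' [] = 2 * M \<and> ints t' ''M'' [] = M \<and>
        (\<exists>x. ?z x t') \<and> (\<exists>\<sigma>. \<sigma> permutes ?I \<and> (\<forall>r\<in>?I. ints t' ''sigma'' [r] = \<sigma> r) \<and>
        (\<forall>\<tau>. \<tau> permutes ?I \<longrightarrow> (\<Sum>r\<in>?I. costs t' r (\<sigma> r)) \<le> (\<Sum>r\<in>?I. costs t' r (\<tau> r))))"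
        using t by simp
    qed simp
  next
    fix t :: memory assume t: "ints t ''n'' [] = 2 * M \<and> ints t ''M'' [] = M \<and>
      (\<exists>x. ?z x t) \<and> (\<exists>\<sigma>. \<sigma> permutes ?I \<and> (\<forall>r\<in>?I. ints t ''sigma'' [r] = \<sigma> r) \<and>
      (\<forall>\<tau>. \<tau> permutes ?I \<longrightarrow> (\<Sum>r\<in>?I. costs t r (\<sigma> r)) \<le> (\<Sum>r\<in>?I. costs t r (\<tau> r))))"
    then obtain x where x: "?z x t" by blast
    obtain \<sigma> where \<sigma>: "\<sigma> permutes ?I" "\<And>r. r \<in> ?I \<Longrightarrow> ints t ''sigma'' [r] = \<sigma> r"
      and opt: "\<And>\<tau>. \<tau> permutes ?I \<Longrightarrow> (\<Sum>r\<in>?I. costs t r (\<sigma> r)) \<le> (\<Sum>r\<in>?I. costs t r (\<tau> r))"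
      using t by blast
    have z: "costs t r m = x - g r m \<and> costs t r (M + m) = x - g r m"
      if "r \<in> ?I" "m \<in> {1..M}" for r m using x that by blast
    have "runs read_pairing t (10 * (2 * M + 1))
      (\<lambda>t'. \<forall>r\<in>?I. ints t' ''l'' [position M (\<sigma> r)] = r)"
      using t \<sigma> by (intro read_pairing_spec) auto
    then show "runs read_pairing t (10 * (2 * M + 1)) ?Q"
    proof (rule runs_mono)
      fix t' :: memory assume l': "\<forall>r\<in>?I. ints t' ''l'' [position M (\<sigma> r)] = r"
      \<comment> \<open>This is the solution \<open>l\<close> of
        \<open>column M \<circ> inv l = \<sigma>\<close>; the written cells turn out to hold exactly
        its values.\<close>
      let ?l = "inv \<sigma> \<circ> column M"
      have l: "?l permutes ?I"
        by (rule permutes_compose[OF column_permutes permutes_inv[OF \<sigma>(1)]])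
      have stored: "ints t' ''l'' [k] = ?l k" if "k \<in> ?I" for k
      proof -
        have "?l k \<in> ?I" using permutes_in_image[OF l] that by blast
        then have "ints t' ''l'' [position M (\<sigma> (?l k))] = ?l k" using l' by blast
        then show ?thesis using permutes_inverses(1)[OF \<sigma>(1)] position_column[OF that] by simp
      qed
      have sp: "stored_pairing t' m = (?l (2 * m - 1), ?l (2 * m))" if "m \<in> {1..M}" for m
      proof -
        have "2 * m - 1 \<in> ?I" "2 * m \<in> ?I" using that by auto
        then show ?thesis unfolding stored_pairing_def using stored by simp
      qed
      have "column M \<circ> inv ?l = \<sigma>"
        using permutes_inv_o(1)[OF column_permutes[of M]] permutes_bij[OF \<sigma>(1)]
          permutes_bij[OF column_permutes[of M]]
        by (simp add: o_inv_distrib bij_imp_bij_inv inv_inv_eq o_assoc)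
      then have val: "pairing_value M g (stored_pairing t') =
          real (2 * M) * x - (\<Sum>r\<in>?I. costs t r (\<sigma> r))"
        using pairing_value_eq_cost[where z = "costs t" and x = x and l = ?l and g = g, OF sp l z] by simp
      have "pairing_value M g \<pi> \<le> pairing_value M g (stored_pairing t')" if \<pi>: "\<pi> \<in> pairings M" for \<pi>
      proof -
        obtain k where k: "k permutes ?I" "\<And>m. m \<in> {1..M} \<Longrightarrow> \<pi> m = (k (2 * m - 1), k (2 * m))"
          using \<pi> by (auto simp: pairings_def)
        \<comment> \<open>An arbitrary pairing yields a competing assignment, so minimality of
          \<open>\<sigma>\<close> bounds its value.\<close>
        have "column M \<circ> inv k permutes ?I"
          by (rule permutes_compose[OF permutes_inv[OF k(1)] column_permutes])
        then show ?thesis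
          using opt pairing_value_eq_cost[where z = "costs t" and x = x and l = k and g = g, OF k(2,1) z] val
          by fastforce
      qed
      moreover have "stored_pairing t' \<in> pairings M" using l sp by (auto simp: pairings_def)
      ultimately show "?Q t'" by (auto simp: is_arg_max_def not_less)
    qed simp
  qed
  \<comment> \<open>\<open>[:1, 2:]\<close> is the polynomial 1 + 2X; the three summands bound
    building the costs, solving the assignment problem and reading off the pairs.\<close>
  moreover have "poly ([:20:] * [:1, 2:]\<^sup>2 + [:60:] * [:1, 2:] ^ 3 + [:10:] * [:1, 2:]) M =
      20 * (2 * M + 1)\<^sup>2 + 60 * (2 * M + 1) ^ 3 + 10 * (2 * M + 1)"
    by (simp add: mult.commute)
  ultimately show "\<exists>t s'. run pairing_program s t s' \<and> ?Q s' \<and>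
      t \<le> poly ([:20:] * [:1, 2:]\<^sup>2 + [:60:] * [:1, 2:] ^ 3 + [:10:] * [:1, 2:]) M"
    by (simp only: runs_def) blast
qed

end
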